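(* Let $d\ge 1$ be an integer, $K=d+3$, and let $\overline{\gamma}=(\gamma_1,\dots,\gamma_d)\in\mathbb{R}^d$ satisfy condition (KM). Let $X$ be $\mathbb{R}^2$ with a norm $\|\cdot\|_X$ whose closed unit ball $BX$ is a symmetric convex polygon with $2K$ sides such that the slopes of its $K$ pairwise non-parallel sides are $\gamma_1,\dots,\gamma_d,0,1,\infty$. Then there is a compact set $E\subset X$ of Hausdorff dimension $2$ such that the one-dimensional Lebesgue measure of $\Delta_X(E)$ is $0$.
   Context: Slopes are with respect to the standard coordinates: the slope of a non-degenerate segment on the line $u_1x_1+u_2x_2+u_0=0$ is $-u_1/u_2$ (and $\infty$ if $u_2=0$). For a positive integer $L$ let $\mathcal{L}(L)=\{\overline{l}=(l_1,\dots,l_d)\in\mathbb{Z}^d: 0\le l_k<L \text{ for } k=1,\dots,d\}$. A vector $\overline{\gamma}\in\mathbb{R}^d$ satisfies condition (KM) if for every positive integer $L$ and every $\varepsilon>0$, $$\inf\Big|\sum_{\overline{l}\in\mathcal{L}(L)} n_{\overline{l}}\,\gamma_1^{l_1}\cdots\gamma_d^{l_d}\Big|\cdot\Big(\max_{\overline{l}\in\mathcal{L}(L)}|n_{\overline{l}}|\Big)^{(1+\varepsilon)L^d}>0,$$ the infimum being over all nonzero integer vectors $(n_{\overline{l}})_{\overline{l}\in\mathcal{L}(L)}$. For $E\subset X$, $\Delta_X(E)=\{\|x-x'\|_X: x,x'\in E\}$. *)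

theory Defs
  imports "HOL-Analysis.Analysis"
begin

definition multi_idx :: "nat \<Rightarrow> ('d::finite \<Rightarrow> nat) set" where
  "multi_idx L = {l. \<forall>k. l k < L}"

definition KM_condition :: "real^'d::finite \<Rightarrow> bool" where
  "KM_condition \<gamma> \<longleftrightarrow>
     (\<forall>L::nat. L > 0 \<longrightarrow> (\<forall>\<epsilon>::real. \<epsilon> > 0 \<longrightarrow>
        Inf { \<bar>\<Sum>l\<in>multi_idx L. real_of_int (n l) * (\<Prod>k\<in>UNIV. (\<gamma> $ k) ^ (l k))\<bar>
              * (Max ((\<lambda>l. real_of_int \<bar>n l\<bar>) ` multi_idx L)) powr ((1 + \<epsilon>) * real L ^ CARD('d))
            | n :: ('d \<Rightarrow> nat) \<Rightarrow> int. \<exists>l\<in>multi_idx L. n l \<noteq> 0 } > 0))"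

definition is_norm_fun :: "('a::real_vector \<Rightarrow> real) \<Rightarrow> bool" where
  "is_norm_fun N \<longleftrightarrow> (\<forall>x. N x = 0 \<longleftrightarrow> x = 0) \<and> (\<forall>c x. N (c *\<^sub>R x) = \<bar>c\<bar> * N x)
     \<and> (\<forall>x y. N (x + y) \<le> N x + N y)"

definition seg_slope :: "real^2 \<Rightarrow> real^2 \<Rightarrow> ereal" where
  "seg_slope p q = (if q $ 1 = p $ 1 then PInfty else ereal ((q $ 2 - p $ 2) / (q $ 1 - p $ 1)))"

definition edge_slope :: "(real^2) set \<Rightarrow> ereal" where
  "edge_slope F = (SOME s. \<exists>p\<in>F. \<exists>q\<in>F. p \<noteq> q \<and> s = seg_slope p q)"

definition diam_wrt :: "('a \<Rightarrow> 'a \<Rightarrow> real) \<Rightarrow> 'a set \<Rightarrow> ennreal" where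
  "diam_wrt \<delta> U = (SUP p\<in>U \<times> U. ennreal (\<delta> (fst p) (snd p)))"

definition hausdorff_content :: "('a \<Rightarrow> 'a \<Rightarrow> real) \<Rightarrow> real \<Rightarrow> real \<Rightarrow> 'a set \<Rightarrow> ennreal" where
  "hausdorff_content \<delta> s r E =
     (INF U \<in> {U :: nat \<Rightarrow> 'a set. E \<subseteq> (\<Union>i. U i) \<and> (\<forall>i. diam_wrt \<delta> (U i) \<le> ennreal r)}.
        (\<Sum>i. if U i = {} then 0 else if s = 0 then 1 else ennreal (enn2real (diam_wrt \<delta> (U i)) powr s)))"

definition hausdorff_measure :: "('a \<Rightarrow> 'a \<Rightarrow> real) \<Rightarrow> real \<Rightarrow> 'a set \<Rightarrow> ennreal" where
  "hausdorff_measure \<delta> s E = (SUP r\<in>{0<..}. hausdorff_content \<delta> s r E)"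

definition hausdorff_dim :: "('a \<Rightarrow> 'a \<Rightarrow> real) \<Rightarrow> 'a set \<Rightarrow> real" where
  "hausdorff_dim \<delta> E = Inf {s. s \<ge> 0 \<and> hausdorff_measure \<delta> s E = 0}"

definition dist_set :: "('a::real_vector \<Rightarrow> real) \<Rightarrow> 'a set \<Rightarrow> real set" where
  "dist_set N E = {N (x - x') | x x'. x \<in> E \<and> x' \<in> E}"

end

theory Submission
  imports Defs
begin

text \<open>
  Every distance is, up to finitely many scalings, a value of one of the functionals $x_1$ and
  $x_2 - c x_1$ (with $c \in \{0, 1, \gamma_1, \dots, \gamma_d\}$) on $E - E$, because a unit vector
  lies on an edge and the functional parallel to that edge is constant and nonzero there.  So it is
  enough to find $E = C \times C$ of dimension 2 such that the sets $C - cC - C + cC$ are null.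

  Let $A$ consist of the sums $\sum_l n_l \gamma^l$ with $l \in \mathcal{L}(L)$ and $0 \le n_l < M$.
  Then $A - cA - A + cA$ consists of integer combinations of monomials in $\mathcal{L}(L+1)$, so it has
  $O(M^{(L+1)^d})$ elements, while (KM) with $(1 + \varepsilon) L^d = (L+1)^d$ separates the $M^{L^d}$ points
  of $A$ by a multiple of $M^{-(L+1)^d}$.  After $A$ is scaled to unit length, the separation gains
  another factor $1/M$.  Hence for large $M$ the difference set has small total length at the scale of
  the separation, although $A$ has nearly full dimension since $L^d / ((L+1)^d + 1) \to 1$.

  Such sets serve as digit sets of the Cantor set $C$, with $L$ growing so slowly that no single
  scale matters.  Sending the mixed radix digits of $t \in [0,1)$ to the point of $C$ with the
  corresponding digits has an inverse that is Hoelder of every exponent below 1, which transports a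
  cover of $C \times C$ to one of the unit square and bounds the Hausdorff measure from below.
\<close>

section \<open>Digit sets from condition (KM)\<close>

definition monom_at :: "real^'d::finite \<Rightarrow> ('d \<Rightarrow> nat) \<Rightarrow> real" where
  "monom_at \<gamma> l = (\<Prod>k\<in>UNIV. (\<gamma> $ k) ^ l k)"

definition int_comb :: "real^'d::finite \<Rightarrow> nat \<Rightarrow> (('d \<Rightarrow> nat) \<Rightarrow> int) \<Rightarrow> real" where
  "int_comb \<gamma> L n = (\<Sum>l\<in>multi_idx L. real_of_int (n l) * monom_at \<gamma> l)"

lemma multi_idx_eq_PiE: "(multi_idx L :: ('d::finite \<Rightarrow> nat) set) = (UNIV \<rightarrow>\<^sub>E {..<L})"
  by (auto simp: multi_idx_def PiE_def Pi_def extensional_def)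

lemma finite_multi_idx [simp]: "finite (multi_idx L)"
  by (simp add: multi_idx_eq_PiE finite_PiE)

lemma card_multi_idx: "card (multi_idx L :: ('d::finite \<Rightarrow> nat) set) = L ^ CARD('d)"
  by (simp add: multi_idx_eq_PiE card_PiE)

lemma int_comb_diff:
  "int_comb \<gamma> L n - int_comb \<gamma> L m = int_comb \<gamma> L (\<lambda>l. n l - m l)"
  by (simp add: int_comb_def algebra_simps sum_subtractf)

lemma int_comb_add:
  "int_comb \<gamma> L n + int_comb \<gamma> L m = int_comb \<gamma> L (\<lambda>l. n l + m l)"
  by (simp add: int_comb_def algebra_simps sum.distrib)

lemma int_comb_cong:
  "(\<And>l. l \<in> multi_idx L \<Longrightarrow> n l = m l) \<Longrightarrow> int_comb \<gamma> L n = int_comb \<gamma> L m"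
  by (simp add: int_comb_def)

lemma abs_int_comb_le:
  assumes "\<And>l. l \<in> multi_idx L \<Longrightarrow> \<bar>n l\<bar> \<le> B"
  shows "\<bar>int_comb \<gamma> L n\<bar> \<le> real_of_int B * (\<Sum>l\<in>multi_idx L. \<bar>monom_at \<gamma> l\<bar>)"
proof -
  have "\<bar>real_of_int (n l)\<bar> \<le> real_of_int B" if "l \<in> multi_idx L" for l
    using assms[OF that] by linarith
  then show ?thesis
    unfolding int_comb_def sum_distrib_left
    by (intro order_trans[OF sum_abs] sum_mono) (simp add: abs_mult mult_right_mono)
qed

text \<open>The infimum in (KM) itself serves as \<kappa>. The maximum of the coefficients may be
  replaced by any upper bound \<open>B\<close> because the exponent is nonnegative. The exponent
  \<open>(L + 1) ^ CARD('d)\<close> is also the number of monomials in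
  \<open>multi_idx (L + 1)\<close>, so separation and counting can be compared later.\<close>

lemma KM_separation:
  fixes \<gamma> :: "real^'d::finite"
  assumes KM: "KM_condition \<gamma>" and L: "L > 0"
  obtains \<kappa> where "\<kappa> > 0"
    "\<And>l n B. \<lbrakk>l \<in> multi_idx L; n l \<noteq> 0; \<And>l. l \<in> multi_idx L \<Longrightarrow> \<bar>n l\<bar> \<le> int B\<rbrakk> \<Longrightarrow>
       \<kappa> \<le> \<bar>int_comb \<gamma> L n\<bar> * real B ^ ((L + 1) ^ CARD('d))"
proof -
  \<comment> \<open>With this choice the exponent \<open>(1 + \<epsilon>) L^d\<close> in (KM) is the integer \<open>(L + 1)^d\<close>.\<close>
  define \<epsilon> :: real where "\<epsilon> = (real (L + 1) / real L) ^ CARD('d) - 1"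
  have "1 < (real (L + 1) / real L) ^ CARD('d)"
    using L by (intro one_less_power) (auto simp: field_simps)
  then have \<epsilon>: "\<epsilon> > 0" by (simp add: \<epsilon>_def)
  have exponent: "(1 + \<epsilon>) * real L ^ CARD('d) = real ((L + 1) ^ CARD('d))"
    using L by (simp add: \<epsilon>_def power_divide)
  let ?f = "\<lambda>n :: ('d \<Rightarrow> nat) \<Rightarrow> int. \<bar>\<Sum>l\<in>multi_idx L. real_of_int (n l) * (\<Prod>k\<in>UNIV. (\<gamma> $ k) ^ (l k))\<bar>
              * (Max ((\<lambda>l. real_of_int \<bar>n l\<bar>) ` multi_idx L)) powr ((1 + \<epsilon>) * real L ^ CARD('d))"
  let ?S = "{?f n | n. \<exists>l\<in>multi_idx L. n l \<noteq> 0}"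
  have pos: "Inf ?S > 0"
    by (rule KM[unfolded KM_condition_def, rule_format, OF L \<epsilon>])
  have bdd: "bdd_below ?S"
    by (rule bdd_belowI[of _ 0]) auto
  show ?thesis
  proof (rule that[OF pos])
    fix l and n :: "('d \<Rightarrow> nat) \<Rightarrow> int" and B
    assume l: "l \<in> multi_idx L" "n l \<noteq> 0" and B: "\<And>l. l \<in> multi_idx L \<Longrightarrow> \<bar>n l\<bar> \<le> int B"
    let ?M = "Max ((\<lambda>l. real_of_int \<bar>n l\<bar>) ` multi_idx L)"
    have "Inf ?S \<le> ?f n"
      by (intro cInf_lower[OF _ bdd] CollectI exI[of _ n] conjI refl bexI[of _ l] l)
    also have "?f n = \<bar>int_comb \<gamma> L n\<bar> * ?M powr real ((L + 1) ^ CARD('d))"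
      unfolding exponent int_comb_def monom_at_def ..
    also have "?M \<ge> real_of_int \<bar>n l\<bar>"
      using l(1) by (intro Max_ge) auto
    then have M1: "?M > 0" using l(2) by linarith
    then have "?M powr real ((L + 1) ^ CARD('d)) = ?M ^ ((L + 1) ^ CARD('d))"
      by (rule powr_realpow)
    also have "?M \<le> real B"
    proof (rule Max.boundedI)
      fix r assume "r \<in> (\<lambda>l. real_of_int \<bar>n l\<bar>) ` multi_idx L"
      then obtain l' where "l' \<in> multi_idx L" "r = real_of_int \<bar>n l'\<bar>" by blast
      then show "r \<le> real B" using B[of l'] by linarith
    qed (use l(1) in auto)
    then have "?M ^ ((L + 1) ^ CARD('d)) \<le> real B ^ ((L + 1) ^ CARD('d))"
      using M1 by (intro power_mono) auto
    finally show "Inf ?S \<le> \<bar>int_comb \<gamma> L n\<bar> * real B ^ ((L + 1) ^ CARD('d))"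
      by (simp add: mult_left_mono)
  qed
qed

text \<open>Multiplication by \<open>c\<close> acts on monomials as an injective map
  \<open>h\<close> of exponent vectors. The coefficients are carried along \<open>h\<close> and set
  to 0 off its image, so they keep the bound \<open>B\<close>.\<close>

lemma int_comb_transfer:
  assumes inj: "inj_on h (multi_idx L)" and sub: "h ` multi_idx L \<subseteq> multi_idx L'"
    and mon: "\<And>l. l \<in> multi_idx L \<Longrightarrow> monom_at \<gamma> (h l) = c * monom_at \<gamma> l"
    and B: "\<And>l. l \<in> multi_idx L \<Longrightarrow> \<bar>n l\<bar> \<le> B" "0 \<le> B"
  shows "\<exists>m. c * int_comb \<gamma> L n = int_comb \<gamma> L' m \<and> (\<forall>l. \<bar>m l\<bar> \<le> B)"
proof -
  define m where "m l = (if l \<in> h ` multi_idx L then n (inv_into (multi_idx L) h l) else 0)" for l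
  have "int_comb \<gamma> L' m = (\<Sum>l\<in>h ` multi_idx L. real_of_int (m l) * monom_at \<gamma> l)"
    unfolding int_comb_def using sub by (intro sum.mono_neutral_right) (auto simp: m_def)
  also have "\<dots> = (\<Sum>l\<in>multi_idx L. real_of_int (m (h l)) * monom_at \<gamma> (h l))"
    by (simp add: sum.reindex[OF inj])
  also have "\<dots> = c * int_comb \<gamma> L n"
    unfolding int_comb_def sum_distrib_left
    by (rule sum.cong) (auto simp: m_def inj mon)
  finally have "c * int_comb \<gamma> L n = int_comb \<gamma> L' m" ..
  moreover have "\<bar>m l\<bar> \<le> B" for l
    using B inv_into_into[of l h "multi_idx L"] by (simp add: m_def)
  ultimately show ?thesis by blast
qed

text \<open>For \<open>c = \<gamma> $ k\<close> the exponent of the \<open>k\<close>-th variable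
  goes up by one, which is why the index set grows from \<open>L\<close> to
  \<open>L + 1\<close>.\<close>

lemma int_comb_times:
  fixes \<gamma> :: "real^'d::finite"
  assumes c: "c \<in> insert 0 (insert 1 (range (($) \<gamma>)))"
    and B: "\<And>l. l \<in> multi_idx L \<Longrightarrow> \<bar>n l\<bar> \<le> B" "0 \<le> B"
  shows "\<exists>m. c * int_comb \<gamma> L n = int_comb \<gamma> (L + 1) m \<and> (\<forall>l. \<bar>m l\<bar> \<le> B)"
proof -
  consider "c = 0" | "c = 1" | k where "c = \<gamma> $ k" using c by auto
  then show ?thesis
  proof cases
    case 1
    then show ?thesis using B by (intro exI[of _ "\<lambda>_. 0"]) (auto simp: int_comb_def)
  next
    case 2
    show ?thesis
      by (rule int_comb_transfer[where h = id])
         (use B in \<open>auto simp: 2 multi_idx_def intro: less_SucI\<close>)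
  next
    case 3
    let ?h = "\<lambda>l. l(k := Suc (l k))"
    have "monom_at \<gamma> (?h l) = c * monom_at \<gamma> l" for l
    proof -
      have "monom_at \<gamma> (?h l) = (\<gamma> $ k) ^ Suc (l k) * (\<Prod>j\<in>UNIV - {k}. (\<gamma> $ j) ^ l j)"
        by (simp add: monom_at_def prod.remove[of UNIV k])
      also have "\<dots> = c * monom_at \<gamma> l"
        by (simp add: monom_at_def prod.remove[of UNIV k] 3)
      finally show ?thesis .
    qed
    moreover have "inj_on ?h (multi_idx L)"
    proof (intro inj_onI ext)
      fix l l' j assume "?h l = ?h l'"
      then have "?h l j = ?h l' j" by (rule fun_cong)
      then show "l j = l' j" by (simp split: if_splits)
    qed
    moreover have "?h ` multi_idx L \<subseteq> multi_idx (L + 1)"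
      by (auto simp: multi_idx_def less_Suc_eq_le less_imp_le Suc_le_eq)
    ultimately show ?thesis
      by (intro int_comb_transfer[where h = ?h] B) auto
  qed
qed

text \<open>The values of the functional \<open>z $ 2 - c * z $ 1\<close> on differences of points
  of the square of \<open>A\<close>; \<open>x\<close> plays the second coordinate and
  \<open>y\<close> the first. For \<open>c = 0\<close> this is the plain difference set of
  \<open>A\<close>.\<close>

definition twisted_diffs :: "real \<Rightarrow> real set \<Rightarrow> real set" where
  "twisted_diffs c A = {x - c * y - (x' - c * y') | x y x' y'. x \<in> A \<and> y \<in> A \<and> x' \<in> A \<and> y' \<in> A}"

text \<open>The shift \<open>u\<close> cancels in a twisted difference. What remains, up to the
  factor \<open>1 / w\<close>, is an integer combination over \<open>multi_idx (L + 1)\<close>: the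
  coefficients from \<open>x - x'\<close> and from \<open>c * (y' - y)\<close> are each at most
  \<open>M\<close> in absolute value, which leaves \<open>4 * M + 1\<close> choices per
  monomial.\<close>

lemma card_twisted_diffs_le:
  fixes \<gamma> :: "real^'d::finite"
  assumes c: "c \<in> insert 0 (insert 1 (range (($) \<gamma>)))"
    and A: "\<And>x. x \<in> A \<Longrightarrow> \<exists>n. x = (int_comb \<gamma> L n + u) / w \<and> (\<forall>l\<in>multi_idx L. 0 \<le> n l \<and> n l < int M)"
  shows "finite (twisted_diffs c A)" "card (twisted_diffs c A) \<le> (4 * M + 1) ^ ((L + 1) ^ CARD('d))"
proof -
  let ?I = "multi_idx (L + 1) :: ('d \<Rightarrow> nat) set"
  let ?P = "?I \<rightarrow>\<^sub>E {- 2 * int M..2 * int M}"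
  have sub: "twisted_diffs c A \<subseteq> (\<lambda>m. int_comb \<gamma> (L + 1) m / w) ` ?P"
  proof
    fix z assume "z \<in> twisted_diffs c A"
    then obtain x y x' y' where z: "z = x - c * y - (x' - c * y')"
      and xs: "x \<in> A" "y \<in> A" "x' \<in> A" "y' \<in> A"
      by (auto simp: twisted_diffs_def)
    obtain n1 n2 n3 n4 where
      n1: "x = (int_comb \<gamma> L n1 + u) / w" "\<forall>l\<in>multi_idx L. 0 \<le> n1 l \<and> n1 l < int M" and
      n2: "y = (int_comb \<gamma> L n2 + u) / w" "\<forall>l\<in>multi_idx L. 0 \<le> n2 l \<and> n2 l < int M" and
      n3: "x' = (int_comb \<gamma> L n3 + u) / w" "\<forall>l\<in>multi_idx L. 0 \<le> n3 l \<and> n3 l < int M" and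
      n4: "y' = (int_comb \<gamma> L n4 + u) / w" "\<forall>l\<in>multi_idx L. 0 \<le> n4 l \<and> n4 l < int M"
      using A[OF xs(1)] A[OF xs(2)] A[OF xs(3)] A[OF xs(4)] by blast
    have b1: "\<bar>n1 l - n3 l\<bar> \<le> int M" if "l \<in> multi_idx L" for l
      using n1(2)[rule_format, OF that] n3(2)[rule_format, OF that] by linarith
    have b2: "\<bar>n4 l - n2 l\<bar> \<le> int M" if "l \<in> multi_idx L" for l
      using n2(2)[rule_format, OF that] n4(2)[rule_format, OF that] by linarith
    obtain m1 where m1: "1 * int_comb \<gamma> L (\<lambda>l. n1 l - n3 l) = int_comb \<gamma> (L + 1) m1" "\<forall>l. \<bar>m1 l\<bar> \<le> int M"
      using int_comb_times[of 1 \<gamma> L "\<lambda>l. n1 l - n3 l" "int M"] b1 by auto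
    obtain m2 where m2: "c * int_comb \<gamma> L (\<lambda>l. n4 l - n2 l) = int_comb \<gamma> (L + 1) m2" "\<forall>l. \<bar>m2 l\<bar> \<le> int M"
      using int_comb_times[OF c, of L "\<lambda>l. n4 l - n2 l" "int M"] b2 by auto
    \<comment> \<open>Restriction makes \<open>m\<close> an element of the extensional function
      space \<open>?P\<close>, whose cardinality is known.\<close>
    define m where "m = restrict (\<lambda>l. m1 l + m2 l) ?I"
    have "z = (1 * (int_comb \<gamma> L n1 - int_comb \<gamma> L n3) + c * (int_comb \<gamma> L n4 - int_comb \<gamma> L n2)) / w"
      unfolding z n1(1) n2(1) n3(1) n4(1) by (simp add: add_divide_distrib diff_divide_distrib algebra_simps)
    also have "\<dots> = (int_comb \<gamma> (L + 1) m1 + int_comb \<gamma> (L + 1) m2) / w"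
      by (simp only: int_comb_diff m1(1) m2(1))
    also have "\<dots> = int_comb \<gamma> (L + 1) m / w"
      unfolding int_comb_add by (rule arg_cong2[OF int_comb_cong refl]) (simp add: m_def)
    finally have "z = int_comb \<gamma> (L + 1) m / w" .
    moreover have "m1 l + m2 l \<in> {- 2 * int M..2 * int M}" for l
      using m1(2)[rule_format, of l] m2(2)[rule_format, of l] by auto
    then have "m \<in> ?P"
      by (auto simp: m_def)
    ultimately show "z \<in> (\<lambda>m. int_comb \<gamma> (L + 1) m / w) ` ?P" by blast
  qed
  have fin: "finite ?P" by (intro finite_PiE) auto
  show "finite (twisted_diffs c A)"
    using sub fin finite_surj by blast
  have "card (twisted_diffs c A) \<le> card ?P"
    using sub fin by (rule surj_card_le[rotated])
  also have "card ?P = (4 * M + 1) ^ ((L + 1) ^ CARD('d))"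
    by (simp add: card_PiE card_multi_idx nat_add_distrib) (simp add: nat_mult_distrib)
  finally show "card (twisted_diffs c A) \<le> (4 * M + 1) ^ ((L + 1) ^ CARD('d))" .
qed

text \<open>With p = L^d and q = (L+1)^d there are M^p digits; after normalisation they are
  separated by a multiple of M^-(q+1) and have at most (5M)^q twisted differences. First
  \<open>L\<close> is chosen with \<alpha>(q+1) < p, then a large \<open>M\<close> absorbs all
  constants.\<close>

lemma exists_digits:
  fixes \<gamma> :: "real^'d::finite"
  assumes KM: "KM_condition \<gamma>" and \<alpha>: "0 < \<alpha>" "\<alpha> < 1"
  shows "\<exists>N \<delta> a. 2 \<le> N \<and> 0 < \<delta> \<and> \<delta> \<le> 1/2 \<and> (\<forall>i<N. 0 \<le> a i \<and> a i \<le> 1/2)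
           \<and> (\<forall>i<N. \<forall>j<N. i \<noteq> j \<longrightarrow> 2 * \<delta> \<le> \<bar>a i - a j\<bar>)
           \<and> (1 / \<delta>) powr \<alpha> \<le> real N
           \<and> (\<forall>c\<in>insert 0 (insert 1 (range (($) \<gamma>))).
                 finite (twisted_diffs c (a ` {..<N})) \<and> real (card (twisted_diffs c (a ` {..<N}))) * \<delta> \<le> 1/2)"
proof -
  define d where "d = CARD('d)"
  have d: "d > 0" by (simp add: d_def)
  \<comment> \<open>The sequence is ((L+1)^d + 1) / L^d, that is, (q+1)/p; its limit is 1 because d
    is positive.\<close>
  have "(\<lambda>L::nat. (1 + 1 / real L) ^ d + (1 / real L) ^ d) \<longlonglongrightarrow> (1 + 0) ^ d + 0 ^ d"
    by (intro tendsto_intros lim_1_over_n)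
  then have "(\<lambda>L::nat. (1 + 1 / real L) ^ d + (1 / real L) ^ d) \<longlonglongrightarrow> 1"
    using d by (simp add: zero_power)
  moreover have "1 < 1 / \<alpha>" using \<alpha> by simp
  ultimately have "\<forall>\<^sub>F L in sequentially. (1 + 1 / real L) ^ d + (1 / real L) ^ d < 1 / \<alpha>"
    by (rule order_tendstoD)
  then have "\<forall>\<^sub>F L in sequentially. L > 0 \<and> (1 + 1 / real L) ^ d + (1 / real L) ^ d < 1 / \<alpha>"
    using eventually_gt_at_top[of 0] by eventually_elim simp
  then obtain L where L: "L > 0" "(1 + 1 / real L) ^ d + (1 / real L) ^ d < 1 / \<alpha>"
    using eventually_happens'[OF sequentially_bot] by blast
  define p q where "p = L ^ d" and "q = (L + 1) ^ d"
  have "((1 + 1 / real L) ^ d + (1 / real L) ^ d) * real L ^ d = real q + 1"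
    using L(1) by (simp add: q_def distrib_right flip: power_mult_distrib) (simp add: field_simps)
  moreover have "((1 + 1 / real L) ^ d + (1 / real L) ^ d) * real L ^ d < 1 / \<alpha> * real L ^ d"
    using L by (intro mult_strict_right_mono) auto
  ultimately have pq: "\<alpha> * real (q + 1) < real p"
    using \<alpha> by (simp add: p_def field_simps)
  have p: "p > 0" using L(1) by (simp add: p_def)

  obtain \<kappa> where \<kappa>: "\<kappa> > 0" and sep:
    "\<And>l n B. \<lbrakk>l \<in> multi_idx L; n l \<noteq> 0; \<And>l. l \<in> multi_idx L \<Longrightarrow> \<bar>n l\<bar> \<le> int B\<rbrakk> \<Longrightarrow>
       \<kappa> \<le> \<bar>int_comb \<gamma> L n\<bar> * real B ^ q"
    by (rule KM_separation[OF KM L(1), folded d_def, folded q_def]) (rule that, assumption, blast)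
  \<comment> \<open>The sum bounds the combinations with coefficients below \<open>M\<close> by
    \<Gamma>M; the summand 1 keeps \<Gamma> away from 0.\<close>
  define \<Gamma> where "\<Gamma> = 1 + (\<Sum>l\<in>multi_idx L. \<bar>monom_at \<gamma> l\<bar>)"
  have \<Gamma>: "\<Gamma> \<ge> 1" by (simp add: \<Gamma>_def sum_nonneg)
  \<comment> \<open>The 8 is the product of the 4 in the normalisation \<open>\<phi>\<close> and the
    2 in the required separation \<open>2 * \<delta>\<close>.\<close>
  define \<kappa>' where "\<kappa>' = \<kappa> / (8 * \<Gamma>)"
  have \<kappa>': "\<kappa>' > 0" using \<kappa> \<Gamma> by (simp add: \<kappa>'_def)

  define e where "e = real p - \<alpha> * real (q + 1)"
  have e: "e > 0" using pq by (simp add: e_def)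
  \<comment> \<open>The second bound makes (5M)^q \<delta> = 5^q \<kappa>'/M at most 1/2. The third
    makes M^e dominate the constant \<open>(1 / \<kappa>') powr \<alpha>\<close>, so that M^p
    reaches \<open>(1 / \<delta>) powr \<alpha>\<close>.\<close>
  obtain M :: nat where "max 2 (max (2 * \<kappa>' * 5 ^ q) (((1 / \<kappa>') powr \<alpha>) powr (1 / e))) \<le> real M"
    using real_arch_simple by blast
  then have M: "M \<ge> 2" "real M \<ge> 2 * \<kappa>' * 5 ^ q" and M': "((1 / \<kappa>') powr \<alpha>) powr (1 / e) \<le> real M"
    by auto
  have "(1 / \<kappa>') powr \<alpha> = (((1 / \<kappa>') powr \<alpha>) powr (1 / e)) powr e"
    using e \<kappa>' by (simp add: powr_powr)
  also have "\<dots> \<le> real M powr e"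
    using M' e by (intro powr_mono2) auto
  finally have M\<kappa>: "(1 / \<kappa>') powr \<alpha> \<le> real M powr (real p - \<alpha> * real (q + 1))"
    by (simp add: e_def)

  define \<delta> where "\<delta> = \<kappa>' / real M ^ (q + 1)"
  have \<delta>: "\<delta> > 0" using \<kappa>' M by (simp add: \<delta>_def)
  have \<delta>5: "(5 * real M) ^ q * \<delta> \<le> 1/2"
    using M \<kappa>' by (simp add: \<delta>_def power_mult_distrib field_simps)
  moreover have "1 \<le> (5 * real M) ^ q" using M by (intro one_le_power) simp
  then have "1 * \<delta> \<le> (5 * real M) ^ q * \<delta>" using \<delta> by (intro mult_right_mono) auto
  ultimately have \<delta>_half: "\<delta> \<le> 1/2" by simp
  have size: "(1 / \<delta>) powr \<alpha> \<le> real (M ^ p)"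
  proof -
    have "1 / \<delta> = (1 / \<kappa>') * real M powr real (q + 1)"
      using M by (subst powr_realpow) (auto simp: \<delta>_def)
    then have "(1 / \<delta>) powr \<alpha> = (1 / \<kappa>') powr \<alpha> * (real M powr real (q + 1)) powr \<alpha>"
      using \<kappa>' by (simp only: powr_mult)
    also have "\<dots> = (1 / \<kappa>') powr \<alpha> * real M powr (\<alpha> * real (q + 1))"
      by (simp only: powr_powr mult.commute)
    also have "\<dots> \<le> real M powr (real p - \<alpha> * real (q + 1)) * real M powr (\<alpha> * real (q + 1))"
      using M\<kappa> by (intro mult_right_mono) auto
    also have "\<dots> = real (M ^ p)"
      using M by (simp add: powr_add[symmetric] powr_realpow)
    finally show ?thesis .
  qed

  let ?I = "multi_idx L :: ('d \<Rightarrow> nat) set"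
  define F where "F = (?I \<rightarrow>\<^sub>E {0..<int M})"
  \<comment> \<open>This affine map carries [-\<Gamma>M, \<Gamma>M], which contains all the
    combinations, onto [0, 1/2].\<close>
  define \<phi> where "\<phi> n = (int_comb \<gamma> L n + \<Gamma> * real M) / (4 * \<Gamma> * real M)" for n
  have finF: "finite F" by (simp add: F_def finite_PiE)
  have cardF: "card F = M ^ p"
    by (simp add: F_def card_PiE card_multi_idx p_def d_def)
  have F: "0 \<le> n l" "n l < int M" if "n \<in> F" "l \<in> ?I" for n l
    using that by (auto simp: F_def PiE_def Pi_def)
  have w: "4 * \<Gamma> * real M > 0" using \<Gamma> M by simp
  have \<phi>_range: "0 \<le> \<phi> n \<and> \<phi> n \<le> 1/2" if "n \<in> F" for n
  proof -
    have "\<bar>int_comb \<gamma> L n\<bar> \<le> real_of_int (int M) * (\<Sum>l\<in>?I. \<bar>monom_at \<gamma> l\<bar>)"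
      using F[OF that] by (intro abs_int_comb_le) (force simp: abs_if)
    also have "\<dots> \<le> \<Gamma> * real M" by (simp add: \<Gamma>_def algebra_simps)
    finally have "\<bar>int_comb \<gamma> L n\<bar> \<le> \<Gamma> * real M" .
    then show ?thesis using w unfolding \<phi>_def by (simp add: field_simps abs_le_iff)
  qed
  have \<phi>_sep: "2 * \<delta> \<le> \<bar>\<phi> n - \<phi> m\<bar>" if nm: "n \<in> F" "m \<in> F" "n \<noteq> m" for n m
  proof -
    obtain l where l: "l \<in> ?I" "n l \<noteq> m l"
      using nm PiE_ext[of n ?I "\<lambda>_. {0..<int M}" m] unfolding F_def by blast
    have "\<bar>n l - m l\<bar> \<le> int M" if "l \<in> ?I" for l
      using F[OF nm(1) that] F[OF nm(2) that] by linarith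
    then have "\<kappa> \<le> \<bar>int_comb \<gamma> L (\<lambda>l. n l - m l)\<bar> * real M ^ q"
      using l by (intro sep[of l]) auto
    also have "int_comb \<gamma> L (\<lambda>l. n l - m l) = (\<phi> n - \<phi> m) * (4 * \<Gamma> * real M)"
      unfolding int_comb_diff[symmetric] \<phi>_def diff_divide_distrib[symmetric] using \<Gamma> M by simp
    finally have "\<kappa> \<le> \<bar>\<phi> n - \<phi> m\<bar> * (4 * \<Gamma> * real M) * real M ^ q"
      using \<Gamma> by (simp add: abs_mult)
    then show ?thesis
      using w M \<Gamma> by (simp add: \<delta>_def \<kappa>'_def field_simps)
  qed
  have inj: "inj_on \<phi> F"
    by (rule inj_onI, rule ccontr) (use \<phi>_sep \<delta> in force)

  \<comment> \<open>From here on \<open>e\<close> is an enumeration of \<open>F\<close>, no longer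
    the gap between the exponents.\<close>
  obtain e where e: "bij_betw e {..<M ^ p} F"
    using ex_bij_betw_nat_finite[OF finF] cardF by (auto simp: atLeast0LessThan)
  have eF: "e i \<in> F" if "i < M ^ p" for i using bij_betwE[OF e] that by auto
  have e_inj: "e i \<noteq> e j" if "i < M ^ p" "j < M ^ p" "i \<noteq> j" for i j
    using inj_onD[OF bij_betw_imp_inj_on[OF e], of i j] that by auto
  have diffs: "finite (twisted_diffs c ((\<phi> \<circ> e) ` {..<M ^ p})) \<and>
      real (card (twisted_diffs c ((\<phi> \<circ> e) ` {..<M ^ p}))) * \<delta> \<le> 1/2"
    if c: "c \<in> insert 0 (insert 1 (range (($) \<gamma>)))" for c
  proof -
    have A: "\<exists>n. x = (int_comb \<gamma> L n + \<Gamma> * real M) / (4 * \<Gamma> * real M) \<and> (\<forall>l\<in>?I. 0 \<le> n l \<and> n l < int M)"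
      if "x \<in> (\<phi> \<circ> e) ` {..<M ^ p}" for x
    proof -
      from that obtain i where i: "i < M ^ p" "x = \<phi> (e i)" by auto
      then show ?thesis using F[OF eF[OF i(1)]] by (intro exI[of _ "e i"]) (simp add: \<phi>_def)
    qed
    have "card (twisted_diffs c ((\<phi> \<circ> e) ` {..<M ^ p})) \<le> (4 * M + 1) ^ q"
      using card_twisted_diffs_le(2)[OF c A] by (simp add: q_def d_def)
    also have "\<dots> \<le> (5 * M) ^ q" using M by (intro power_mono) auto
    finally have "real (card (twisted_diffs c ((\<phi> \<circ> e) ` {..<M ^ p}))) \<le> (5 * real M) ^ q"
      using of_nat_mono[where 'a = real] by fastforce
    then have "real (card (twisted_diffs c ((\<phi> \<circ> e) ` {..<M ^ p}))) * \<delta> \<le> (5 * real M) ^ q * \<delta>"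
      using \<delta> by (intro mult_right_mono) auto
    with \<delta>5 card_twisted_diffs_le(1)[OF c A] show ?thesis by simp
  qed
  have "2 \<le> M ^ p"
    using M(1) self_le_power[of M p] p by linarith
  then show ?thesis
    using \<delta> \<delta>_half size diffs \<phi>_range eF \<phi>_sep e_inj
    by (intro exI[of _ "M ^ p"] exI[of _ \<delta>] exI[of _ "\<phi> \<circ> e"]) auto
qed

section \<open>Cantor sets with prescribed digit sets\<close>

text \<open>A diagonal choice: \<open>n j\<close> is the largest index up to \<open>j\<close> whose
  threshold \<open>T\<close> has been passed at \<open>j\<close>. The bound by \<open>j\<close>
  keeps the set of candidates finite, and admitting 0 without condition keeps it nonempty.\<close>

lemma exists_slow_index:
  assumes "\<And>m. \<forall>\<^sub>F j in sequentially. Q m j"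
  shows "\<exists>n :: nat \<Rightarrow> nat. filterlim n at_top sequentially \<and> (\<forall>\<^sub>F j in sequentially. Q (n j) j)"
proof -
  obtain T where T: "\<And>m j. j \<ge> T m \<Longrightarrow> Q m j"
    using assms unfolding eventually_sequentially by metis
  define S where "S j = {n. n \<le> j \<and> (n = 0 \<or> T n \<le> j)}" for j
  have fin: "finite (S j)" for j
    by (rule finite_subset[of _ "{..j}"]) (auto simp: S_def)
  define n where "n j = Max (S j)" for j
  have n_ge: "m \<le> n j" if "j \<ge> max m (T m)" for m j
    unfolding n_def by (rule Max_ge[OF fin]) (use that in \<open>auto simp: S_def\<close>)
  have n_in: "n j \<in> S j" for j
    unfolding n_def by (rule Max_in[OF fin]) (auto simp: S_def)
  have "Q (n j) j" if "j \<ge> max 1 (T 1)" for j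
    using n_in[of j] n_ge[OF that] by (intro T) (auto simp: S_def)
  moreover have "filterlim n at_top sequentially"
    unfolding filterlim_at_top eventually_sequentially using n_ge by blast
  ultimately show ?thesis
    unfolding eventually_sequentially by blast
qed

text \<open>Digits of at most 1/2 and ratios of at most 1/2 bound the tail from level n on by the
  product of the first n ratios. The separation \<open>2 * \<delta> j\<close> is twice the tail that
  follows level j.\<close>

locale digit_system =
  fixes N :: "nat \<Rightarrow> nat" and \<delta> :: "nat \<Rightarrow> real" and a :: "nat \<Rightarrow> nat \<Rightarrow> real"
  assumes N_ge: "2 \<le> N j"
    and \<delta>_pos: "0 < \<delta> j" and \<delta>_le: "\<delta> j \<le> 1/2"
    and digit_range: "i < N j \<Longrightarrow> 0 \<le> a j i \<and> a j i \<le> 1/2"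
    and digit_sep: "\<lbrakk>i < N j; i' < N j; i \<noteq> i'\<rbrakk> \<Longrightarrow> 2 * \<delta> j \<le> \<bar>a j i - a j i'\<bar>"
begin

text \<open>
  \<open>prefix j t\<close> encodes the first \<open>j\<close> mixed radix digits of \<open>t\<close> in a single number, so two
  points of \<open>[0,1)\<close> with the same prefix are at distance at most \<open>1 / pieces j\<close>.
\<close>

definition scale :: "nat \<Rightarrow> real" where "scale j = (\<Prod>i<j. \<delta> i)"
definition pieces :: "nat \<Rightarrow> nat" where "pieces j = (\<Prod>i<j. N i)"
definition prefix :: "nat \<Rightarrow> real \<Rightarrow> nat" where "prefix j t = nat \<lfloor>real (pieces j) * t\<rfloor>"
definition digit :: "nat \<Rightarrow> real \<Rightarrow> nat" where "digit j t = prefix (Suc j) t mod N j"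
definition place :: "real \<Rightarrow> real" where "place t = (\<Sum>j. scale j * a j (digit j t))"
text \<open>The image of \<open>place\<close> need not be closed: digit sequences that end in
  maximal digits are not produced by the floor function.\<close>

definition cantor_set :: "real set" where "cantor_set = closure (place ` {0..<1})"

lemma scale_simps [simp]: "scale 0 = 1" "scale (Suc j) = scale j * \<delta> j"
  by (simp_all add: scale_def)

lemma pieces_simps [simp]: "pieces 0 = 1" "pieces (Suc j) = pieces j * N j"
  by (simp_all add: pieces_def)

lemma scale_pos: "0 < scale j"
  using \<delta>_pos by (simp add: scale_def prod_pos)

lemma scale_add_le: "scale (n + j) \<le> scale n * (1/2) ^ j"
proof (induction j)
  case (Suc j)
  have "scale (n + j) * \<delta> (n + j) \<le> scale n * (1/2) ^ j * (1/2)"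
    using Suc \<delta>_le \<delta>_pos[of "n + j"] scale_pos[of n] by (intro mult_mono) auto
  then show ?case by simp
qed simp

lemma pieces_ge: "2 ^ j \<le> pieces j"
proof (induction j)
  case (Suc j)
  then show ?case using mult_mono[OF Suc N_ge[of j]] by (simp add: mult.commute)
qed simp

lemma pieces_pos: "0 < pieces j"
  using pieces_ge[of j] by (metis less_le_trans zero_less_numeral zero_less_power)

lemma digit_less: "digit j t < N j"
  using N_ge[of j] by (simp add: digit_def)

text \<open>Division by \<open>N j\<close> removes the last mixed radix digit, since the floor of a
  quotient by an integer depends only on the floor of the numerator.\<close>

lemma prefix_Suc_div:
  assumes "0 \<le> t"
  shows "prefix (Suc j) t div N j = prefix j t"
proof -
  have "real (pieces j) * t = real (pieces (Suc j)) * t / real_of_int (int (N j))"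
    using N_ge[of j] by simp
  then have "\<lfloor>real (pieces j) * t\<rfloor> = \<lfloor>real (pieces (Suc j)) * t / real_of_int (int (N j))\<rfloor>"
    by (rule arg_cong)
  also have "\<dots> = \<lfloor>real (pieces (Suc j)) * t\<rfloor> div int (N j)"
    by (rule floor_divide_real_eq_div) simp
  finally have "\<lfloor>real (pieces j) * t\<rfloor> = \<lfloor>real (pieces (Suc j)) * t\<rfloor> div int (N j)" .
  moreover have "0 \<le> \<lfloor>real (pieces (Suc j)) * t\<rfloor>"
    using assms by simp
  ultimately show ?thesis
    unfolding prefix_def by (simp only: nat_div_distrib nat_int)
qed

lemma prefix_eq_imp_close:
  assumes "0 \<le> t" "0 \<le> t'" "prefix j t = prefix j t'"
  shows "\<bar>t - t'\<bar> \<le> 1 / real (pieces j)"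
proof -
  let ?P = "real (pieces j)"
  have P: "?P > 0" using pieces_pos by simp
  have "\<lfloor>?P * t\<rfloor> = \<lfloor>?P * t'\<rfloor>"
    using assms P unfolding prefix_def by (simp add: nat_eq_iff split: if_splits)
  then have "\<bar>?P * t - ?P * t'\<bar> \<le> 1" by linarith
  then have "?P * \<bar>t - t'\<bar> \<le> 1"
    using P by (simp add: abs_mult flip: right_diff_distrib)
  then show ?thesis using P by (simp add: field_simps)
qed

text \<open>At the least level \<open>Suc i\<close> with different prefixes, the prefixes of level
  \<open>i\<close> still agree. This gives the closeness and the agreement of the earlier digits,
  and it forces the difference into the last digit. Such a level exists because
  \<open>pieces\<close> is unbounded.\<close>

lemma first_difference:
  assumes t: "0 \<le> t" "t < 1" "0 \<le> t'" "t' < 1" and "t \<noteq> t'"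
  obtains i where "\<bar>t - t'\<bar> \<le> 1 / real (pieces i)" "\<And>k. k < i \<Longrightarrow> digit k t = digit k t'"
    "digit i t \<noteq> digit i t'"
proof -
  have "\<exists>j. prefix j t \<noteq> prefix j t'"
  proof (rule ccontr)
    assume "\<nexists>j. prefix j t \<noteq> prefix j t'"
    then have close: "\<bar>t - t'\<bar> \<le> 1 / real (pieces j)" for j
      using prefix_eq_imp_close t by blast
    obtain j where j: "(1/2::real) ^ j < \<bar>t - t'\<bar>"
      using real_arch_pow_inv[of "\<bar>t - t'\<bar>" "1/2"] \<open>t \<noteq> t'\<close> by auto
    have "1 / real (pieces j) \<le> 1 / 2 ^ j"
      using of_nat_mono[OF pieces_ge[of j], where 'a = real] pieces_pos[of j]
      by (intro divide_left_mono) auto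
    then show False using close[of j] j by (simp add: power_one_over)
  qed
  moreover define j where "j = (LEAST j. prefix j t \<noteq> prefix j t')"
  ultimately have j: "prefix j t \<noteq> prefix j t'"
    by (metis (mono_tags, lifting) LeastI_ex)
  have below: "prefix k t = prefix k t'" if "k < j" for k
    using not_less_Least[of k "\<lambda>j. prefix j t \<noteq> prefix j t'"] that by (auto simp: j_def)
  \<comment> \<open>On [0,1) the prefix of level 0 is always 0, so the least differing level is a
    successor.\<close>
  have "prefix 0 t = 0" "prefix 0 t' = 0" using t by (auto simp: prefix_def floor_eq_iff)
  with j obtain i where i: "j = Suc i" by (cases j) auto
  show ?thesis
  proof (rule that[of i])
    show "\<bar>t - t'\<bar> \<le> 1 / real (pieces i)"
      using below i t by (intro prefix_eq_imp_close) auto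
    show "digit k t = digit k t'" if "k < i" for k
      using below[of "Suc k"] that i by (simp add: digit_def)
    show "digit i t \<noteq> digit i t'"
    proof
      assume "digit i t = digit i t'"
      moreover have "prefix (Suc i) t div N i = prefix (Suc i) t' div N i"
        using below[of i] i t by (simp add: prefix_Suc_div)
      ultimately show False
        using j i unfolding digit_def by (metis div_mult_mod_eq)
    qed
  qed
qed

section \<open>Tails and separation of the points of the Cantor set\<close>

lemma digit_term_bounds:
  "0 \<le> scale j * a j (digit j t)" "scale j * a j (digit j t) \<le> scale j * (1/2)"
  using digit_range[OF digit_less, of j t] scale_pos[of j] by auto

lemma summable_place: "summable (\<lambda>j. scale j * a j (digit j t))"
proof (rule summable_comparison_test'[of "\<lambda>j. (1/2::real) ^ j"])
  show "norm (scale j * a j (digit j t)) \<le> (1/2) ^ j" if "j \<ge> 0" for j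
  proof -
    have "scale j \<le> (1/2) ^ j" using scale_add_le[of 0 j] by simp
    then show ?thesis
      using digit_term_bounds[of j t] scale_pos[of j] unfolding real_norm_def by linarith
  qed
qed (simp add: summable_geometric)

lemma place_tail:
  "(\<Sum>j<n. scale j * a j (digit j t)) \<le> place t"
  "place t \<le> (\<Sum>j<n. scale j * a j (digit j t)) + scale n"
proof -
  let ?f = "\<lambda>j. scale j * a j (digit j t)"
  have split: "place t = (\<Sum>j. ?f (j + n)) + (\<Sum>j<n. ?f j)"
    unfolding place_def by (rule suminf_split_initial_segment[OF summable_place])
  have sm: "summable (\<lambda>j. ?f (j + n))"
    using summable_place by (simp add: summable_iff_shift[where f = ?f])
  have "0 \<le> (\<Sum>j. ?f (j + n))"
    using digit_term_bounds by (intro suminf_nonneg sm)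
  then show "(\<Sum>j<n. ?f j) \<le> place t" using split by simp
  have geo: "(\<lambda>j. scale n / 2 * (1/2) ^ j) sums (scale n / 2 * (1 / (1 - 1/2)))"
    by (intro sums_mult geometric_sums) simp
  have "(\<Sum>j. ?f (j + n)) \<le> (\<Sum>j. scale n / 2 * (1/2) ^ j)"
  proof (intro suminf_le sm sums_summable[OF geo])
    show "?f (j + n) \<le> scale n / 2 * (1/2) ^ j" for j
      using digit_term_bounds(2)[of "j + n" t] scale_add_le[of n j] by (simp add: add.commute)
  qed
  also have "\<dots> = scale n" using sums_unique[OF geo] by simp
  finally show "place t \<le> (\<Sum>j<n. ?f j) + scale n" using split by simp
qed

lemma place_sep:
  assumes t: "0 \<le> t" "t < 1" "0 \<le> t'" "t' < 1" and "t \<noteq> t'"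
  obtains i where "\<bar>t - t'\<bar> \<le> 1 / real (pieces i)" "scale (Suc i) \<le> \<bar>place t - place t'\<bar>"
proof -
  obtain i where i: "\<bar>t - t'\<bar> \<le> 1 / real (pieces i)" "\<And>k. k < i \<Longrightarrow> digit k t = digit k t'"
    "digit i t \<noteq> digit i t'"
    using first_difference[OF assms] by blast
  \<comment> \<open>The first differing digit contributes at least twice the length of the remaining tail.\<close>
  let ?S = "\<lambda>t. \<Sum>j<Suc i. scale j * a j (digit j t)"
  have "(\<Sum>j<i. scale j * a j (digit j t)) = (\<Sum>j<i. scale j * a j (digit j t'))"
    using i(2) by (intro sum.cong) auto
  then have "?S t - ?S t' = scale i * (a i (digit i t) - a i (digit i t'))"
    by (simp add: algebra_simps)
  moreover have "2 * \<delta> i \<le> \<bar>a i (digit i t) - a i (digit i t')\<bar>"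
    by (intro digit_sep digit_less i(3))
  ultimately have "2 * scale (Suc i) \<le> \<bar>?S t - ?S t'\<bar>"
    using scale_pos[of i] by (simp add: abs_mult)
  then have "scale (Suc i) \<le> \<bar>place t - place t'\<bar>"
    using place_tail[where n = "Suc i" and t = t] place_tail[where n = "Suc i" and t = t'] by linarith
  with i(1) show ?thesis by (rule that)
qed

text \<open>With \<open>i\<close> the first differing level, the parameters are within
  \<open>1 / pieces i\<close> while their images are at least \<open>scale (Suc i)\<close> apart.
  Hence the hypothesis on \<open>c\<close> pairs these two different levels.\<close>

lemma place_Holder:
  assumes c: "c > 0" "\<And>i. c \<le> real (pieces i) * scale (Suc i) powr \<alpha>" and \<alpha>: "\<alpha> \<ge> 0"
    and t: "t \<in> {0..<1}" "t' \<in> {0..<1}"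
  shows "c * \<bar>t - t'\<bar> \<le> \<bar>place t - place t'\<bar> powr \<alpha>"
proof (cases "t = t'")
  case False
  then obtain i where i: "\<bar>t - t'\<bar> \<le> 1 / real (pieces i)" "scale (Suc i) \<le> \<bar>place t - place t'\<bar>"
    using place_sep[of t t'] t by auto
  have "c * \<bar>t - t'\<bar> \<le> real (pieces i) * scale (Suc i) powr \<alpha> * (1 / real (pieces i))"
    using c i by (intro mult_mono) auto
  also have "\<dots> = scale (Suc i) powr \<alpha>" using pieces_pos[of i] by simp
  also have "\<dots> \<le> \<bar>place t - place t'\<bar> powr \<alpha>"
    using i(2) \<alpha> scale_pos[of "Suc i"] by (intro powr_mono2) auto
  finally show ?thesis .
qed simp

lemma cantor_set_bounds: "cantor_set \<subseteq> {0..1}"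
proof -
  have "place t \<in> {0..1}" for t
    using place_tail[where n = 0 and t = t] by simp
  then show ?thesis unfolding cantor_set_def by (intro closure_minimal) auto
qed

lemma compact_cantor_set: "compact cantor_set"
  using cantor_set_bounds bounded_closed_interval[of "0::real" 1]
  by (metis bounded_subset cantor_set_def closed_closure compact_eq_bounded_closed)

section \<open>Finite approximations and null difference sets\<close>

primrec nodes :: "nat \<Rightarrow> real set" where
  "nodes 0 = {0}"
| "nodes (Suc j) = (\<lambda>(u, i). u + scale j * a j i) ` (nodes j \<times> {..<N j})"

lemma finite_nodes: "finite (nodes j)"
  by (induction j) auto

lemma partial_sum_in_nodes: "(\<Sum>j<n. scale j * a j (digit j t)) \<in> nodes n"
  using digit_less by (induction n) (auto intro!: image_eqI)

text \<open>The intervals of length \<open>scale n\<close> to the right of the nodes form a finite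
  union of closed sets, so covering the image of \<open>place\<close> is enough to cover its
  closure.\<close>

lemma cantor_set_near_nodes:
  assumes "x \<in> cantor_set"
  shows "\<exists>u\<in>nodes n. u \<le> x \<and> x \<le> u + scale n"
proof -
  let ?U = "\<Union>u\<in>nodes n. {u..u + scale n}"
  have "closed ?U" using finite_nodes by (intro closed_UN) auto
  moreover have "place ` {0..<1} \<subseteq> ?U"
  proof
    fix x assume "x \<in> place ` {0..<1}"
    then obtain t where "x = place t" by blast
    then show "x \<in> ?U"
      using place_tail[where n = n and t = t] partial_sum_in_nodes[of t n]
      by (intro UN_I[where a = "\<Sum>j<n. scale j * a j (digit j t)"]) auto
  qed
  ultimately have "cantor_set \<subseteq> ?U"
    unfolding cantor_set_def by (rule closure_minimal[rotated])
  then show ?thesis using assms by force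
qed

text \<open>By linearity a twisted difference of nodes of level \<open>Suc n\<close> is one of level
  \<open>n\<close> plus \<open>scale n\<close> times one of digits. So cardinality times scale is
  submultiplicative, and each level contributes a factor of at most 1/2.\<close>

lemma card_twisted_diffs_nodes:
  assumes D: "\<And>j. finite (twisted_diffs c (a j ` {..<N j}))"
    "\<And>j. real (card (twisted_diffs c (a j ` {..<N j}))) * \<delta> j \<le> 1/2"
  shows "finite (twisted_diffs c (nodes n)) \<and> real (card (twisted_diffs c (nodes n))) * scale n \<le> (1/2) ^ n"
proof (induction n)
  case 0
  have "twisted_diffs c {0} = {0}" by (auto simp: twisted_diffs_def)
  then show ?case by simp
next
  case (Suc n)
  let ?D = "twisted_diffs c (nodes n)" and ?A = "twisted_diffs c (a n ` {..<N n})"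
  let ?f = "\<lambda>(w, e). w + scale n * e"
  have sub: "twisted_diffs c (nodes (Suc n)) \<subseteq> ?f ` (?D \<times> ?A)"
  proof
    fix z assume "z \<in> twisted_diffs c (nodes (Suc n))"
    then obtain x1 x2 x3 x4 where z: "z = x1 - c * x2 - (x3 - c * x4)"
      and x: "x1 \<in> nodes (Suc n)" "x2 \<in> nodes (Suc n)" "x3 \<in> nodes (Suc n)" "x4 \<in> nodes (Suc n)"
      unfolding twisted_diffs_def by blast
    have step: "\<exists>u i. u \<in> nodes n \<and> i < N n \<and> x = u + scale n * a n i" if "x \<in> nodes (Suc n)" for x
      using that by auto
    obtain u1 u2 u3 u4 i1 i2 i3 i4 where
      u: "u1 \<in> nodes n" "u2 \<in> nodes n" "u3 \<in> nodes n" "u4 \<in> nodes n" and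
      i: "i1 < N n" "i2 < N n" "i3 < N n" "i4 < N n" and
      x_eq: "x1 = u1 + scale n * a n i1" "x2 = u2 + scale n * a n i2"
        "x3 = u3 + scale n * a n i3" "x4 = u4 + scale n * a n i4"
      using step[OF x(1)] step[OF x(2)] step[OF x(3)] step[OF x(4)] by metis
    have "u1 - c * u2 - (u3 - c * u4) \<in> ?D"
      unfolding twisted_diffs_def using u by blast
    moreover have "a n i1 - c * a n i2 - (a n i3 - c * a n i4) \<in> ?A"
      unfolding twisted_diffs_def using i by blast
    moreover have "z = u1 - c * u2 - (u3 - c * u4) + scale n * (a n i1 - c * a n i2 - (a n i3 - c * a n i4))"
      unfolding z x_eq by (simp add: algebra_simps)
    ultimately show "z \<in> ?f ` (?D \<times> ?A)" by (simp only: image_iff) force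
  qed
  have fin: "finite (?D \<times> ?A)" using Suc D(1) by blast
  have "card (twisted_diffs c (nodes (Suc n))) \<le> card ?D * card ?A"
    using surj_card_le[OF fin sub] by (simp add: card_cartesian_product)
  then have "real (card (twisted_diffs c (nodes (Suc n)))) \<le> real (card ?D) * real (card ?A)"
    by (metis of_nat_le_iff of_nat_mult)
  then have "real (card (twisted_diffs c (nodes (Suc n)))) * scale (Suc n)
      \<le> real (card ?D) * real (card ?A) * scale (Suc n)"
    using scale_pos[of "Suc n"] by (intro mult_right_mono) auto
  also have "\<dots> = (real (card ?D) * scale n) * (real (card ?A) * \<delta> n)" by simp
  also have "\<dots> \<le> (1/2) ^ n * (1/2)"
    using Suc D(2)[of n] \<delta>_pos[of n] scale_pos[of n] by (intro mult_mono) auto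
  finally show ?case
    using finite_subset[OF sub finite_imageI[OF fin]] by simp
qed

text \<open>Moving each of the four points to a node changes a twisted difference by at most
  \<open>r\<close>. Intervals of radius \<open>r\<close> around the twisted differences of the nodes
  therefore cover, with total length at most C / 2^n.\<close>

lemma negligible_twisted_diffs:
  assumes D: "\<And>j. finite (twisted_diffs c (a j ` {..<N j}))"
    "\<And>j. real (card (twisted_diffs c (a j ` {..<N j}))) * \<delta> j \<le> 1/2"
  shows "negligible (twisted_diffs c cantor_set)"
  unfolding negligible_outer_le
proof (intro allI impI)
  fix e :: real assume e: "e > 0"
  define C where "C = 2 * (2 + 2 * \<bar>c\<bar>)"
  have C: "C > 0" by (simp add: C_def add_pos_nonneg)
  obtain n where n: "(1/2::real) ^ n < e / C"
    using real_arch_pow_inv[of "e / C" "1/2"] e C by auto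
  define r where "r = (2 + 2 * \<bar>c\<bar>) * scale n"
  let ?D = "twisted_diffs c (nodes n)"
  let ?T = "\<Union>w\<in>?D. cbox (w - r) (w + r)"
  have fin: "finite ?D" and card: "real (card ?D) * scale n \<le> (1/2) ^ n"
    using card_twisted_diffs_nodes[OF D] by auto
  have "twisted_diffs c cantor_set \<subseteq> ?T"
  proof
    fix z assume "z \<in> twisted_diffs c cantor_set"
    then obtain x1 x2 x3 x4 where z: "z = x1 - c * x2 - (x3 - c * x4)"
      and x: "x1 \<in> cantor_set" "x2 \<in> cantor_set" "x3 \<in> cantor_set" "x4 \<in> cantor_set"
      unfolding twisted_diffs_def by blast
    have near: "\<exists>u. u \<in> nodes n \<and> \<bar>x - u\<bar> \<le> scale n" if "x \<in> cantor_set" for x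
      using cantor_set_near_nodes[OF that, of n] by force
    obtain u1 u2 u3 u4 where u: "u1 \<in> nodes n" "u2 \<in> nodes n" "u3 \<in> nodes n" "u4 \<in> nodes n"
      and ux: "\<bar>x1 - u1\<bar> \<le> scale n" "\<bar>x2 - u2\<bar> \<le> scale n" "\<bar>x3 - u3\<bar> \<le> scale n" "\<bar>x4 - u4\<bar> \<le> scale n"
      using near[OF x(1)] near[OF x(2)] near[OF x(3)] near[OF x(4)] by blast
    let ?w = "u1 - c * u2 - (u3 - c * u4)"
    have "z - ?w = (x1 - u1) - (x3 - u3) + (c * (x4 - u4) - c * (x2 - u2))"
      by (simp add: z algebra_simps)
    moreover have "\<bar>c * (x4 - u4)\<bar> \<le> \<bar>c\<bar> * scale n" "\<bar>c * (x2 - u2)\<bar> \<le> \<bar>c\<bar> * scale n"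
      using ux by (simp_all add: abs_mult mult_left_mono)
    ultimately have "\<bar>z - ?w\<bar> \<le> scale n + scale n + (\<bar>c\<bar> * scale n + \<bar>c\<bar> * scale n)"
      using ux by linarith
    also have "\<dots> = r" by (simp add: r_def algebra_simps)
    finally have "z \<in> cbox (?w - r) (?w + r)" by (simp add: abs_le_iff)
    moreover have "?w \<in> ?D" unfolding twisted_diffs_def using u by blast
    ultimately show "z \<in> ?T" by blast
  qed
  moreover have T: "?T \<in> lmeasurable"
    using fin by (intro fmeasurable.finite_UN) auto
  moreover have "measure lebesgue ?T \<le> e"
  proof -
    have r: "r \<ge> 0" using scale_pos[of n] by (simp add: r_def)
    have "measure lebesgue ?T \<le> (\<Sum>w\<in>?D. measure lebesgue (cbox (w - r) (w + r)))"
      using fin by (intro measure_UNION_le) auto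
    also have "\<dots> = real (card ?D) * (2 * r)" using r by simp
    also have "\<dots> = C * (real (card ?D) * scale n)" by (simp add: r_def C_def)
    also have "\<dots> \<le> C * (1/2) ^ n" using card C by (intro mult_left_mono) auto
    also have "\<dots> \<le> e" using n C by (simp add: field_simps)
    finally show ?thesis .
  qed
  ultimately show "\<exists>T. twisted_diffs c cantor_set \<subseteq> T \<and> T \<in> lmeasurable \<and> measure lebesgue T \<le> e"
    by blast
qed

end

text \<open>The product \<open>Q i\<close> of \<open>pieces i\<close> and
  \<open>scale i powr \<alpha>\<close> eventually grows by at least \<open>2 powr \<beta>\<close>
  per level, because the exponents in \<open>big\<close> tend to 1. Passing from
  \<open>scale i\<close> to \<open>scale (Suc i)\<close> costs one factor
  \<open>\<delta> i powr \<alpha>\<close>; by the slow growth in \<open>small\<close> this costs at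
  most \<open>2 powr (\<beta> * i)\<close>, which the growth of \<open>Q\<close>
  compensates.\<close>

lemma (in digit_system) pieces_scale_bounded_below:
  assumes n: "filterlim n at_top sequentially"
    and big: "\<And>j. (1 / \<delta> j) powr (1 - 1 / (real (n j) + 2)) \<le> real (N j)"
    and small: "\<forall>\<^sub>F j in sequentially. (1 / \<delta> j) ^ (n j + 1) \<le> 2 ^ j"
    and \<alpha>: "0 < \<alpha>" "\<alpha> < 1"
  shows "\<exists>c>0. \<forall>i. c \<le> real (pieces i) * scale (Suc i) powr \<alpha>"
proof -
  \<comment> \<open>Half the gap, so that \<alpha> + \<beta> = 1 - \<beta>; this lies below the
    exponent in \<open>big\<close> once 1/(n j + 2) \<le> \<beta>.\<close>
  define \<beta> where "\<beta> = (1 - \<alpha>) / 2"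
  have \<beta>: "\<beta> > 0" using \<alpha> by (simp add: \<beta>_def)
  have "\<forall>\<^sub>F j in sequentially. nat \<lceil>1 / \<beta>\<rceil> \<le> n j"
    by (rule n[unfolded filterlim_at_top, rule_format])
  with small have "\<forall>\<^sub>F j in sequentially. 2 powr \<beta> \<le> real (N j) * \<delta> j powr \<alpha> \<and> 2 powr (- \<beta> * real j) \<le> \<delta> j powr \<alpha>"
  proof eventually_elim
    case (elim j)
    have "1 / \<beta> \<le> real (n j)" using elim(2) by linarith
    then have "1 / (real (n j) + 2) \<le> \<beta>" and n1: "1 / (real (n j) + 1) \<le> \<beta>"
      using \<beta> by (auto simp: field_simps)
    have d: "1 / \<delta> j \<ge> 2" "\<delta> j > 0" using \<delta>_pos[of j] \<delta>_le[of j] by (auto simp: field_simps)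
    have "2 powr \<beta> \<le> (1 / \<delta> j) powr \<beta>"
      using d \<beta> by (intro powr_mono2) auto
    also have "\<dots> = (1 / \<delta> j) powr (\<alpha> + \<beta>) * \<delta> j powr \<alpha>"
      using d by (simp add: powr_add powr_divide)
    also have "(1 / \<delta> j) powr (\<alpha> + \<beta>) \<le> (1 / \<delta> j) powr (1 - 1 / (real (n j) + 2))"
      using d \<open>1 / (real (n j) + 2) \<le> \<beta>\<close> by (intro powr_mono) (auto simp: \<beta>_def field_simps)
    also have "\<dots> \<le> real (N j)" by (rule big)
    finally have 1: "2 powr \<beta> \<le> real (N j) * \<delta> j powr \<alpha>"
      by (simp add: mult_right_mono)
    \<comment> \<open>Taking the root of order n j + 1 in \<open>small\<close> turns the bound 2^j
      into an arbitrarily small exponential rate.\<close>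
    have "1 / \<delta> j = ((1 / \<delta> j) ^ (n j + 1)) powr (1 / (real (n j) + 1))"
      using d by (simp add: powr_powr add.commute[of 1] flip: powr_realpow del: power_Suc)
    also have "\<dots> \<le> (2 ^ j) powr (1 / (real (n j) + 1))"
      using elim(1) d by (intro powr_mono2) auto
    also have "\<dots> = 2 powr (real j * (1 / (real (n j) + 1)))"
      by (simp add: powr_powr flip: powr_realpow)
    also have "\<dots> \<le> 2 powr (real j * \<beta>)"
      using n1 by (intro powr_mono mult_left_mono) auto
    finally have "1 / \<delta> j \<le> 2 powr (real j * \<beta>)" .
    then have "(1 / \<delta> j) powr \<alpha> \<le> (2 powr (real j * \<beta>)) powr \<alpha>"
      using d \<alpha> by (intro powr_mono2) auto
    also have "\<dots> = 2 powr (real j * \<beta> * \<alpha>)" by (rule powr_powr)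
    also have "\<dots> \<le> 2 powr (real j * \<beta> * 1)"
      using \<alpha> \<beta> by (intro powr_mono mult_left_mono) auto
    finally have "(1 / \<delta> j) powr \<alpha> \<le> 2 powr (\<beta> * real j)" by (simp add: mult.commute)
    then have 2: "2 powr (- \<beta> * real j) \<le> \<delta> j powr \<alpha>"
      using d by (simp add: powr_divide powr_minus field_simps)
    from 1 2 show ?case ..
  qed
  then obtain k where k: "\<And>i. i \<ge> k \<Longrightarrow> 2 powr \<beta> \<le> real (N i) * \<delta> i powr \<alpha>"
    "\<And>i. i \<ge> k \<Longrightarrow> 2 powr (- \<beta> * real i) \<le> \<delta> i powr \<alpha>"
    unfolding eventually_sequentially by blast
  define Q where "Q i = real (pieces i) * scale i powr \<alpha>" for i
  have Q_pos: "Q i > 0" for i using pieces_pos[of i] scale_pos[of i] by (simp add: Q_def)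
  have Q_Suc: "Q (Suc i) = Q i * (real (N i) * \<delta> i powr \<alpha>)" for i
    using scale_pos[of i] \<delta>_pos[of i] by (simp add: Q_def powr_mult)
  have Q_ge: "Q k * 2 powr (\<beta> * real m) \<le> Q (k + m)" for m
  proof (induction m)
    case (Suc m)
    have "Q k * 2 powr (\<beta> * real m) * 2 powr \<beta> \<le> Q (k + m) * (real (N (k + m)) * \<delta> (k + m) powr \<alpha>)"
      using Suc k(1)[of "k + m"] Q_pos[of "k + m"] by (intro mult_mono) auto
    then show ?case using Q_Suc[of "k + m"] by (simp add: distrib_left powr_add mult_ac)
  qed simp
  let ?f = "\<lambda>i. real (pieces i) * scale (Suc i) powr \<alpha>"
  have f_eq: "?f i = Q i * \<delta> i powr \<alpha>" for i
    using scale_pos[of i] \<delta>_pos[of i] by (simp add: Q_def powr_mult)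
  have f_pos: "?f i > 0" for i using pieces_pos[of i] scale_pos[of "Suc i"] by (intro mult_pos_pos) auto
  \<comment> \<open>The first term serves the levels beyond \<open>k\<close>, where growth and loss
    cancel up to the offset \<open>k\<close>; the second serves the finitely many others.\<close>
  define c where "c = min (Q k * 2 powr (- \<beta> * real k)) (Min (?f ` {..k}))"
  have "c > 0" unfolding c_def using Q_pos f_pos by simp
  moreover have "c \<le> ?f i" for i
  proof (cases "i \<le> k")
    case True
    then have "Min (?f ` {..k}) \<le> ?f i" by (intro Min_le) auto
    then show ?thesis by (simp add: c_def)
  next
    case False
    then obtain m where m: "i = k + m" using less_imp_add_positive[of k i] by auto
    have "c \<le> Q k * 2 powr (- \<beta> * real k)" by (simp add: c_def)
    also have "\<dots> = Q k * 2 powr (\<beta> * real m) * 2 powr (- \<beta> * real i)"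
      by (simp add: m algebra_simps flip: powr_add)
    also have "\<dots> \<le> Q i * \<delta> i powr \<alpha>"
      using Q_ge[of m] k(2)[of i] Q_pos[of i] False by (intro mult_mono) (auto simp: m)
    finally show ?thesis by (simp only: f_eq)
  qed
  ultimately show ?thesis by blast
qed

text \<open>Digit sets with exponents tending to 1 are distributed over the levels. Each is repeated
  so long, by the slow index \<open>n\<close>, that powers of its inverse ratio stay below
  2^j.\<close>

lemma exists_digit_system:
  assumes digits: "\<And>\<alpha>::real. \<lbrakk>0 < \<alpha>; \<alpha> < 1\<rbrakk> \<Longrightarrow>
     \<exists>N \<delta> a. 2 \<le> N \<and> 0 < \<delta> \<and> \<delta> \<le> 1/2 \<and> (\<forall>i<N. 0 \<le> a i \<and> a i \<le> 1/2)
           \<and> (\<forall>i<N. \<forall>j<N. i \<noteq> j \<longrightarrow> 2 * \<delta> \<le> \<bar>a i - a j\<bar>)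
           \<and> (1 / \<delta>) powr \<alpha> \<le> real N
           \<and> (\<forall>c\<in>S. finite (twisted_diffs c (a ` {..<N})) \<and> real (card (twisted_diffs c (a ` {..<N}))) * \<delta> \<le> 1/2)"
  obtains N \<delta> a where "digit_system N \<delta> a"
    "\<And>c j. c \<in> S \<Longrightarrow> finite (twisted_diffs c (a j ` {..<N j}))"
    "\<And>c j. c \<in> S \<Longrightarrow> real (card (twisted_diffs c (a j ` {..<N j}))) * \<delta> j \<le> 1/2"
    "\<And>\<alpha>. \<lbrakk>0 < \<alpha>; \<alpha> < 1\<rbrakk> \<Longrightarrow> \<exists>c>0. \<forall>i. c \<le> real (digit_system.pieces N i) * digit_system.scale \<delta> (Suc i) powr \<alpha>"
proof -
  \<comment> \<open>The denominator \<open>real m + 2\<close> keeps the exponent strictly between 0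
    and 1 even for \<open>m = 0\<close>.\<close>
  let ?P = "\<lambda>m N \<delta> a. 2 \<le> N \<and> 0 < \<delta> \<and> \<delta> \<le> 1/2 \<and> (\<forall>i<N. 0 \<le> a i \<and> a i \<le> 1/2)
           \<and> (\<forall>i<N. \<forall>j<N. i \<noteq> j \<longrightarrow> 2 * \<delta> \<le> \<bar>a i - a j\<bar>)
           \<and> (1 / \<delta>) powr (1 - 1 / (real m + 2)) \<le> real N
           \<and> (\<forall>c\<in>S. finite (twisted_diffs c (a ` {..<N})) \<and> real (card (twisted_diffs c (a ` {..<N}))) * \<delta> \<le> 1/2)"
  have "\<forall>m. \<exists>N \<delta> a. ?P m N \<delta> a"
    by (intro allI digits) (auto simp: field_simps)
  then obtain N' \<delta>' a' where P: "\<And>m. ?P m (N' m) (\<delta>' m) (a' m)" by metis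
  have "\<forall>\<^sub>F j in sequentially. (1 / \<delta>' m) ^ (m + 1) \<le> 2 ^ j" for m
  proof -
    obtain j0 where "(1 / \<delta>' m) ^ (m + 1) < 2 ^ j0"
      using real_arch_pow[of 2 "(1 / \<delta>' m) ^ (m + 1)"] by auto
    then have "(1 / \<delta>' m) ^ (m + 1) \<le> 2 ^ j" if "j \<ge> j0" for j
      using power_increasing[OF that, of "2::real"] by linarith
    then show ?thesis unfolding eventually_sequentially by blast
  qed
  then obtain n where n: "filterlim n at_top sequentially"
    "\<forall>\<^sub>F j in sequentially. (1 / \<delta>' (n j)) ^ (n j + 1) \<le> 2 ^ j"
    using exists_slow_index[of "\<lambda>m j. (1 / \<delta>' m) ^ (m + 1) \<le> 2 ^ j"] by blast
  interpret digit_system "N' \<circ> n" "\<delta>' \<circ> n" "a' \<circ> n"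
    by standard (use P in auto)
  show ?thesis
  proof (rule that[OF digit_system_axioms])
    show "\<exists>c>0. \<forall>i. c \<le> real (pieces i) * scale (Suc i) powr \<alpha>" if "0 < \<alpha>" "\<alpha> < 1" for \<alpha>
      by (rule pieces_scale_bounded_below[OF n(1)]) (use P n(2) that in auto)
  qed (use P in auto)
qed

section \<open>Hausdorff dimension of planar product sets\<close>

text \<open>The bound \<open>r\<close> makes the diameter finite; \<open>enn2real\<close> would turn
  an infinite one into 0.\<close>

lemma enn2real_diam_bounds:
  assumes "diam_wrt \<delta> U \<le> ennreal r" "p \<in> U" "q \<in> U"
  shows "\<delta> p q \<le> enn2real (diam_wrt \<delta> U)"
proof -
  have "ennreal (\<delta> p q) \<le> diam_wrt \<delta> U"
    unfolding diam_wrt_def using assms(2,3) by (intro SUP_upper2[of "(p, q)"]) auto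
  moreover have "diam_wrt \<delta> U < top"
    using assms(1) by (rule le_less_trans) simp
  ultimately have "enn2real (ennreal (\<delta> p q)) \<le> enn2real (diam_wrt \<delta> U)"
    by (rule enn2real_mono)
  then show ?thesis by (cases "\<delta> p q \<ge> 0") (auto intro: order_trans[OF _ enn2real_nonneg])
qed

text \<open>For exponent 0 every nonempty member of a cover counts 1. This removes s = 0 from the
  infimum that defines the dimension; positive exponents are treated by pulling covers back.\<close>

lemma hausdorff_measure_0_pos:
  assumes "E \<noteq> {}"
  shows "hausdorff_measure \<delta> 0 E \<noteq> 0"
proof -
  have "1 \<le> hausdorff_content \<delta> 0 1 E"
    unfolding hausdorff_content_def
  proof (rule INF_greatest)
    fix U :: "nat \<Rightarrow> 'a set" assume "U \<in> {U. E \<subseteq> (\<Union>i. U i) \<and> (\<forall>i. diam_wrt \<delta> (U i) \<le> ennreal 1)}"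
    then obtain i where i: "U i \<noteq> {}" using assms by fastforce
    let ?f = "\<lambda>i. if U i = {} then 0 else if (0::real) = 0 then 1
      else ennreal (enn2real (diam_wrt \<delta> (U i)) powr 0)"
    have "(\<Sum>i\<in>{i}. ?f i) \<le> (\<Sum>i. ?f i)" by (intro sum_le_suminf) auto
    with i show "1 \<le> (\<Sum>i. ?f i)" by simp
  qed
  also have "\<dots> \<le> hausdorff_measure \<delta> 0 E"
    unfolding hausdorff_measure_def by (intro SUP_upper) simp
  finally show ?thesis by auto
qed

text \<open>A cover of the product set pulls back under \<open>g\<close> in both coordinates to a
  cover of the unit square. A set of diameter D pulls back into a square of area K D^(2\<alpha>), so
  the sum of the D^(2\<alpha>) is at least 1/K.\<close>

lemma hausdorff_measure_cube_pos:
  fixes N :: "real^2 \<Rightarrow> real" and g :: "real \<Rightarrow> real"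
  assumes g: "g ` {0..<1} \<subseteq> C"
    and c: "c > 0" "\<And>t t'. \<lbrakk>t \<in> {0..<1}; t' \<in> {0..<1}\<rbrakk> \<Longrightarrow> c * \<bar>t - t'\<bar> \<le> \<bar>g t - g t'\<bar> powr \<alpha>"
    and \<alpha>: "\<alpha> > 0"
    and R: "R > 0" "\<And>z k. \<bar>z $ k\<bar> \<le> R * N z"
  shows "hausdorff_measure (\<lambda>x y. N (x - y)) (2 * \<alpha>) {z. \<forall>k. z $ k \<in> C} \<noteq> 0"
proof -
  let ?\<delta> = "\<lambda>x y. N (x - y)"
  \<comment> \<open>Chosen so that \<open>(2 * w i) ^ 2 = K * D i powr (2 * \<alpha>)\<close> for
    the half side \<open>w i\<close> below.\<close>
  define K where "K = (2 * R powr \<alpha> / c) ^ 2"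
  have K: "K > 0" using R c by (simp add: K_def)
  have "ennreal (1 / K) \<le> hausdorff_content ?\<delta> (2 * \<alpha>) 1 {z. \<forall>k. z $ k \<in> C}"
    unfolding hausdorff_content_def
  proof (rule INF_greatest)
    fix U :: "nat \<Rightarrow> (real^2) set"
    assume U: "U \<in> {U. {z. \<forall>k. z $ k \<in> C} \<subseteq> (\<Union>i. U i) \<and> (\<forall>i. diam_wrt ?\<delta> (U i) \<le> ennreal 1)}"
    define D where "D i = enn2real (diam_wrt ?\<delta> (U i))" for i
    let ?f = "\<lambda>i. if U i = {} then 0 else if 2 * \<alpha> = 0 then 1 else ennreal (D i powr (2 * \<alpha>))"
    define V where "V i = {s. (\<forall>k. s $ k \<in> {0..<1}) \<and> (\<chi> k. g (s $ k)) \<in> U i}" for i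
    define w where "w i = (R * D i) powr \<alpha> / c" for i
    \<comment> \<open>The preimages \<open>V i\<close> need not be measurable, so each is enclosed
      in a Borel set: a square centred at one of its points.\<close>
    have "\<exists>B\<in>sets lborel. V i \<subseteq> B \<and> emeasure lborel B \<le> ennreal K * ?f i" for i
    proof (cases "V i = {}")
      case True
      then show ?thesis by (intro bexI[of _ "{}"]) auto
    next
      case False
      then obtain s where s: "s \<in> V i" by blast
      have w: "w i \<ge> 0" using c by (simp add: w_def)
      let ?B = "cbox (\<chi> k. s $ k - w i) (\<chi> k. s $ k + w i)"
      have "V i \<subseteq> ?B"
      proof
        fix s' assume s': "s' \<in> V i"
        have "\<bar>s $ k - s' $ k\<bar> \<le> w i" for k
        proof -
          let ?z = "(\<chi> k. g (s $ k)) - (\<chi> k. g (s' $ k))"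
          have "\<bar>g (s $ k) - g (s' $ k)\<bar> \<le> R * N ?z"
            using R(2)[of ?z k] by simp
          also have "N ?z \<le> D i"
            unfolding D_def using s s' U by (intro enn2real_diam_bounds[where \<delta> = ?\<delta> and r = 1]) (auto simp: V_def)
          finally have "\<bar>g (s $ k) - g (s' $ k)\<bar> \<le> R * D i" using R(1) by simp
          then have "\<bar>g (s $ k) - g (s' $ k)\<bar> powr \<alpha> \<le> (R * D i) powr \<alpha>"
            using \<alpha> by (intro powr_mono2) auto
          moreover have "c * \<bar>s $ k - s' $ k\<bar> \<le> \<bar>g (s $ k) - g (s' $ k)\<bar> powr \<alpha>"
            using s s' by (intro c(2)) (auto simp: V_def)
          ultimately have "c * \<bar>s $ k - s' $ k\<bar> \<le> (R * D i) powr \<alpha>" by linarith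
          then show ?thesis using c(1) by (simp add: w_def field_simps)
        qed
        then show "s' \<in> ?B" by (auto simp: mem_box_cart abs_le_iff algebra_simps)
      qed
      moreover have "emeasure lborel ?B \<le> ennreal K * ?f i"
      proof -
        have "measure lborel ?B = (2 * w i) ^ 2"
          using w by (subst content_cbox_cart) (auto simp: interval_ne_empty_cart)
        moreover have "emeasure lborel ?B = ennreal (measure lborel ?B)"
          using emeasure_lborel_cbox_finite[THEN less_imp_neq]
          by (intro emeasure_eq_ennreal_measure) simp
        ultimately have "emeasure lborel ?B = ennreal ((2 * w i) ^ 2)" by simp
        also have "(2 * w i) ^ 2 = K * D i powr (2 * \<alpha>)"
        proof -
          have "D i powr (2 * \<alpha>) = (D i powr \<alpha>) ^ 2"
            by (simp add: power2_eq_square flip: powr_add)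
          then show ?thesis
            using R(1) by (simp add: w_def K_def powr_mult power_divide power_mult_distrib)
        qed
        also have "ennreal (K * D i powr (2 * \<alpha>)) = ennreal K * ?f i"
          using K \<alpha> s by (auto simp: ennreal_mult V_def)
        finally show ?thesis by simp
      qed
      ultimately show ?thesis by (intro bexI[of _ ?B]) auto
    qed
    then obtain B where B: "\<And>i. B i \<in> sets lborel" "\<And>i. V i \<subseteq> B i" "\<And>i. emeasure lborel (B i) \<le> ennreal K * ?f i"
      by metis
    \<comment> \<open>The open square already has area 1 and keeps the coordinates within [0,1),
      where \<open>g\<close> is controlled.\<close>
    have "box 0 (1 :: real^2) \<subseteq> (\<Union>i. B i)"
    proof
      fix s :: "real^2" assume "s \<in> box 0 1"
      then have s: "\<forall>k. s $ k \<in> {0..<1}" by (auto simp: mem_box_cart less_imp_le)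
      then have "(\<chi> k. g (s $ k)) \<in> {z. \<forall>k. z $ k \<in> C}" using g by auto
      then obtain i where "(\<chi> k. g (s $ k)) \<in> U i" using U by blast
      with s have "s \<in> V i" by (simp add: V_def)
      then show "s \<in> (\<Union>i. B i)" using B(2) by blast
    qed
    moreover have "emeasure lborel (box 0 (1 :: real^2)) = 1"
      by (subst emeasure_lborel_box) (auto simp: Basis_vec_def inner_axis intro!: prod.neutral)
    ultimately have "1 \<le> emeasure lborel (\<Union>i. B i)"
      using emeasure_mono[of "box 0 (1 :: real^2)" "\<Union>i. B i" lborel] B(1) by auto
    also have "\<dots> \<le> (\<Sum>i. emeasure lborel (B i))"
      using B(1) by (intro emeasure_subadditive_countably) auto
    also have "\<dots> \<le> (\<Sum>i. ennreal K * ?f i)"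
      using B(3) by (intro suminf_le) auto
    also have "\<dots> = ennreal K * (\<Sum>i. ?f i)" by simp
    finally have "1 \<le> ennreal K * (\<Sum>i. ?f i)" .
    then have "ennreal (1 / K) * 1 \<le> ennreal (1 / K) * (ennreal K * (\<Sum>i. ?f i))"
      by (rule mult_left_mono) simp
    also have "\<dots> = (\<Sum>i. ?f i)"
      using K by (simp add: mult.assoc[symmetric] ennreal_mult[symmetric])
    finally show "ennreal (1 / K) \<le> (\<Sum>i. if U i = {} then 0 else if 2 * \<alpha> = 0 then 1
      else ennreal (enn2real (diam_wrt ?\<delta> (U i)) powr (2 * \<alpha>)))"
      unfolding D_def mult_1_right .
  qed
  also have "\<dots> \<le> hausdorff_measure ?\<delta> (2 * \<alpha>) {z. \<forall>k. z $ k \<in> C}"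
    unfolding hausdorff_measure_def by (intro SUP_upper) simp
  finally show ?thesis using K by auto
qed

text \<open>A grid of (m+1)^2 squares of side 1/m has diameters of at most h = 2R/m. Since m + 1
  \<le> 2m and mh = 2R, the sum (m+1)^2 h^s is at most 4 (2R)^2 h^(s-2), which tends to 0.\<close>

lemma hausdorff_measure_planar_null:
  fixes N :: "real^2 \<Rightarrow> real"
  assumes R: "R > 0" "\<And>z. N z \<le> R * (\<bar>z $ 1\<bar> + \<bar>z $ 2\<bar>)"
    and E: "E \<subseteq> cbox 0 1" and s: "s > 2"
  shows "hausdorff_measure (\<lambda>x y. N (x - y)) s E = 0"
proof -
  let ?\<delta> = "\<lambda>x y. N (x - y)"
  have "hausdorff_content ?\<delta> s r E \<le> 0" if r: "r > 0" for r
  proof (rule ennreal_le_epsilon)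
    fix e :: real assume e: "e > 0"
    define h where "h n = 2 * R / real (Suc n)" for n
    have h0: "h \<longlonglongrightarrow> 0"
    proof -
      have "(\<lambda>n. 2 * R * inverse (real (Suc n))) \<longlonglongrightarrow> 2 * R * 0"
        by (intro tendsto_intros LIMSEQ_inverse_real_of_nat)
      then show ?thesis by (simp add: h_def[abs_def] divide_inverse del: of_nat_Suc)
    qed
    have "(\<lambda>n. h n powr (s - 2)) \<longlonglongrightarrow> 0 powr (s - 2)"
      by (rule tendsto_powr'[OF h0 tendsto_const]) (use R(1) s in \<open>auto simp: h_def\<close>)
    then have "(\<lambda>n. 4 * (2 * R) ^ 2 * h n powr (s - 2)) \<longlonglongrightarrow> 0"
      by (intro tendsto_mult_right_zero) simp
    then have "\<forall>\<^sub>F n in sequentially. h n < r \<and> 4 * (2 * R) ^ 2 * h n powr (s - 2) < e"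
      using order_tendstoD(2)[OF h0 r] order_tendstoD(2)[of _ 0 sequentially e] e
      by (auto intro: eventually_conj)
    then obtain n where n: "h n < r" "4 * (2 * R) ^ 2 * h n powr (s - 2) < e"
      using eventually_happens'[OF sequentially_bot] by blast
    define m where "m = Suc n"
    have m: "m > 0" "real m > 0" by (simp_all add: m_def)
    have h_pos: "h n > 0" using R by (simp add: h_def)
    let ?J = "\<lambda>i. {real i / real m..(real i + 1) / real m}"
    \<comment> \<open>Indices run up to \<open>m\<close> and not \<open>m - 1\<close>, so that the points with a coordinate 1 are covered.\<close>
    define U where "U k = (if k < (m + 1) ^ 2 then
      {z :: real^2. z $ 1 \<in> ?J (k div (m + 1)) \<and> z $ 2 \<in> ?J (k mod (m + 1))} else {})" for k
    have J: "\<bar>x - y\<bar> \<le> 1 / real m" if "x \<in> ?J i" "y \<in> ?J i" for x y i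
    proof -
      have "x - y \<le> (real i + 1) / real m - real i / real m" "y - x \<le> (real i + 1) / real m - real i / real m"
        using that by auto
      then show ?thesis by (simp add: diff_divide_distrib[symmetric] abs_le_iff)
    qed
    have diam: "diam_wrt ?\<delta> (U k) \<le> ennreal (h n)" for k
      unfolding diam_wrt_def
    proof (rule SUP_least)
      fix p assume "p \<in> U k \<times> U k"
      then have "\<bar>(fst p - snd p) $ 1\<bar> \<le> 1 / real m" "\<bar>(fst p - snd p) $ 2\<bar> \<le> 1 / real m"
        using J by (auto simp: U_def split: if_splits)
      then have "R * (\<bar>(fst p - snd p) $ 1\<bar> + \<bar>(fst p - snd p) $ 2\<bar>) \<le> R * (1 / real m + 1 / real m)"
        using R(1) by (intro mult_left_mono) auto
      also have "\<dots> = h n" by (simp add: h_def m_def)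
      finally show "ennreal (N (fst p - snd p)) \<le> ennreal (h n)"
        using R(2)[of "fst p - snd p"] by (intro ennreal_leI) linarith
    qed
    have cover: "E \<subseteq> (\<Union>k. U k)"
    proof
      fix z assume "z \<in> E"
      with E have z: "\<And>k. 0 \<le> z $ k" "\<And>k. z $ k \<le> 1" by (auto simp: mem_box_cart subset_eq)
      define i where "i k = nat \<lfloor>real m * z $ k\<rfloor>" for k
      have i: "real (i k) \<le> real m * z $ k" "real m * z $ k \<le> real (i k) + 1" for k
        using z(1)[of k] m unfolding i_def by simp_all
      have "real (i k) \<le> real m" for k
        using i(1)[of k] mult_left_mono[OF z(2)[of k], of "real m"] by simp
      then have im: "i k \<le> m" for k by simp
      have J: "z $ k \<in> ?J (i k)" for k
        using i[of k] m by (simp add: field_simps)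
      let ?k = "i 1 * (m + 1) + i 2"
      have k: "?k div (m + 1) = i 1" "?k mod (m + 1) = i 2"
        using im[of 2] by (auto simp: div_mult_self3 simp del: mult_Suc_right)
      have "?k \<le> m * (m + 1) + m" using im by (intro add_mono mult_right_mono) auto
      also have "\<dots> < (m + 1) ^ 2" by (simp add: power2_eq_square)
      finally have "z \<in> U ?k" using J k by (simp add: U_def)
      then show "z \<in> (\<Union>k. U k)" by blast
    qed
    let ?f = "\<lambda>k. if U k = {} then 0 else if s = 0 then 1 else ennreal (enn2real (diam_wrt ?\<delta> (U k)) powr s)"
    have "hausdorff_content ?\<delta> s r E \<le> (\<Sum>k. ?f k)"
      unfolding hausdorff_content_def using cover order_trans[OF diam ennreal_leI] n(1)
      by (intro INF_lower) (auto intro: less_imp_le)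
    also have "\<dots> = (\<Sum>k<(m + 1) ^ 2. ?f k)"
      by (rule suminf_finite) (auto simp: U_def)
    also have "\<dots> \<le> (\<Sum>k<(m + 1) ^ 2. ennreal (h n powr s))"
    proof (rule sum_mono)
      fix k
      have "enn2real (diam_wrt ?\<delta> (U k)) \<le> h n"
        using enn2real_mono[OF diam[of k]] h_pos by simp
      then show "?f k \<le> ennreal (h n powr s)"
        using s by (auto intro!: ennreal_leI powr_mono2)
    qed
    also have "\<dots> = ennreal (real ((m + 1) ^ 2) * h n powr s)"
      by (simp add: ennreal_mult ennreal_of_nat_eq_real_of_nat del: of_nat_power)
    also have "\<dots> \<le> ennreal e"
    proof (rule ennreal_leI)
      have "real ((m + 1) ^ 2) \<le> (2 * real m) ^ 2"
        unfolding of_nat_power using m by (intro power_mono) auto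
      then have "real ((m + 1) ^ 2) * h n powr s \<le> (2 * real m) ^ 2 * h n powr s"
        by (intro mult_right_mono) auto
      also have "\<dots> = 4 * (real m * h n) ^ 2 * h n powr (s - 2)"
        using h_pos by (simp add: powr_diff power_mult_distrib)
      also have "real m * h n = 2 * R" by (simp add: h_def m_def)
      finally show "real ((m + 1) ^ 2) * h n powr s \<le> e" using n(2) by linarith
    qed
    finally show "hausdorff_content ?\<delta> s r E \<le> 0 + ennreal e" by simp
  qed
  then show ?thesis
    unfolding hausdorff_measure_def by (auto simp: SUP_eq_iff bot_ennreal intro!: antisym SUP_least)
qed

text \<open>The exponents of measure zero contain everything above 2 and nothing below it, so their
  infimum is 2 whatever happens at 2 itself.\<close>

lemma hausdorff_dim_eq_2:
  assumes pos: "\<And>s. \<lbrakk>0 \<le> s; s < 2\<rbrakk> \<Longrightarrow> hausdorff_measure \<delta> s E \<noteq> 0"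
    and null: "\<And>s. s > 2 \<Longrightarrow> hausdorff_measure \<delta> s E = 0"
  shows "hausdorff_dim \<delta> E = 2"
  unfolding hausdorff_dim_def
proof (rule cInf_eq_non_empty)
  show "{s. 0 \<le> s \<and> hausdorff_measure \<delta> s E = 0} \<noteq> {}"
    using null[of 3] by (intro ex_in_conv[THEN iffD1] exI[of _ 3]) simp
  show "2 \<le> s" if "s \<in> {s. 0 \<le> s \<and> hausdorff_measure \<delta> s E = 0}" for s
    using pos[of s] that by (cases "s < 2") auto
  show "y \<le> 2" if "\<And>s. s \<in> {s. 0 \<le> s \<and> hausdorff_measure \<delta> s E = 0} \<Longrightarrow> y \<le> s" for y
    by (rule dense_ge) (use null that in auto)
qed

section \<open>Norms with polygonal unit ball\<close>

lemma is_norm_fun_0: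
  assumes "is_norm_fun N"
  shows "N 0 = 0"
  using assms unfolding is_norm_fun_def by blast

text \<open>The triangle inequality for x and -x gives 0 \<le> 2 N x.\<close>

lemma is_norm_fun_nonneg:
  assumes "is_norm_fun N"
  shows "0 \<le> N x"
proof -
  have "N (x + (- 1) *\<^sub>R x) \<le> N x + N ((- 1) *\<^sub>R x)"
    using assms unfolding is_norm_fun_def by blast
  moreover have "N 0 = 0" "N ((- 1) *\<^sub>R x) = N x"
    using assms unfolding is_norm_fun_def by (blast, metis abs_minus_cancel abs_one mult_1)
  ultimately show ?thesis by simp
qed

lemma is_norm_fun_pos:
  assumes "is_norm_fun N" "x \<noteq> 0"
  shows "0 < N x"
  using is_norm_fun_nonneg[OF assms(1), of x] assms unfolding is_norm_fun_def by force

lemma is_norm_fun_upper_bound: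
  fixes N :: "real^2 \<Rightarrow> real"
  assumes N: "is_norm_fun N"
  shows "\<exists>R>0. \<forall>z. N z \<le> R * (\<bar>z $ 1\<bar> + \<bar>z $ 2\<bar>)"
proof (intro exI conjI allI)
  let ?R = "N (axis 1 1) + N (axis 2 1) + 1"
  note nn = is_norm_fun_nonneg[OF N]
  show "0 < ?R" using nn by (intro add_nonneg_pos add_nonneg_nonneg) auto
  fix z :: "real^2"
  have "z = z $ 1 *\<^sub>R axis 1 1 + z $ 2 *\<^sub>R axis 2 1"
    by (simp add: vec_eq_iff forall_2 axis_def)
  then have "N z = N (z $ 1 *\<^sub>R axis 1 1 + z $ 2 *\<^sub>R axis 2 1)" by (rule arg_cong)
  also have "\<dots> \<le> \<bar>z $ 1\<bar> * N (axis 1 1) + \<bar>z $ 2\<bar> * N (axis 2 1)"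
    using N unfolding is_norm_fun_def by metis
  also have "\<dots> \<le> \<bar>z $ 1\<bar> * ?R + \<bar>z $ 2\<bar> * ?R"
    using nn[of "axis 1 1"] nn[of "axis 2 1"] by (intro add_mono mult_left_mono) auto
  finally show "N z \<le> ?R * (\<bar>z $ 1\<bar> + \<bar>z $ 2\<bar>)" by (simp add: algebra_simps)
qed

lemma is_norm_fun_lower_bound:
  fixes N :: "real^2 \<Rightarrow> real"
  assumes N: "is_norm_fun N" and "bounded {x. N x \<le> 1}"
  shows "\<exists>R>0. \<forall>z k. \<bar>z $ k\<bar> \<le> R * N z"
proof -
  obtain R where R: "R > 0" "\<And>x. N x \<le> 1 \<Longrightarrow> norm x \<le> R"
    using assms(2) unfolding bounded_pos by blast
  have "\<bar>z $ k\<bar> \<le> R * N z" for z k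
  proof (cases "z = 0")
    case False
    then have pos: "N z > 0" using is_norm_fun_pos[OF N] by blast
    have "N ((1 / N z) *\<^sub>R z) = \<bar>1 / N z\<bar> * N z"
      using N unfolding is_norm_fun_def by blast
    then have "norm ((1 / N z) *\<^sub>R z) \<le> R"
      using pos by (intro R(2)) simp
    then have "norm z \<le> R * N z" using pos by (simp add: field_simps)
    then show ?thesis using component_le_norm_cart[of z k] by linarith
  next
    case True
    then show ?thesis using is_norm_fun_nonneg[OF N, of z] R(1) by simp
  qed
  with R(1) show ?thesis by blast
qed

text \<open>A norm is convex, hence continuous in finite dimension, so its open unit ball is an open
  set.\<close>

lemma less_1_subset_interior:
  fixes N :: "real^2 \<Rightarrow> real"
  assumes N: "is_norm_fun N"
  shows "{x. N x < 1} \<subseteq> interior {x. N x \<le> 1}"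
proof (rule interior_maximal)
  have "convex_on UNIV N"
  proof (rule convex_onI)
    fix t x y assume t: "0 < t" "t < (1::real)"
    have "N ((1 - t) *\<^sub>R x + t *\<^sub>R y) \<le> N ((1 - t) *\<^sub>R x) + N (t *\<^sub>R y)"
      using N unfolding is_norm_fun_def by blast
    also have "\<dots> = \<bar>1 - t\<bar> * N x + \<bar>t\<bar> * N y"
      using N unfolding is_norm_fun_def by metis
    finally show "N ((1 - t) *\<^sub>R x + t *\<^sub>R y) \<le> (1 - t) * N x + t * N y"
      using t by simp
  qed simp
  then have "continuous_on UNIV N"
    by (intro convex_on_continuous) auto
  then show "open {x. N x < 1}"
    by (intro open_Collect_less continuous_on_const)
qed auto

lemma aff_dim_unit_ball:
  fixes N :: "real^2 \<Rightarrow> real"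
  assumes N: "is_norm_fun N"
  shows "interior {x. N x \<le> 1} \<noteq> {}" "aff_dim {x. N x \<le> 1} = 2"
proof -
  have "0 \<in> {x. N x < 1}" by (simp add: is_norm_fun_0[OF N])
  then show *: "interior {x. N x \<le> 1} \<noteq> {}"
    using less_1_subset_interior[OF N] by blast
  then show "aff_dim {x. N x \<le> 1} = 2"
    by (simp add: aff_dim_nonempty_interior)
qed

text \<open>Stretching a unit vector slightly leaves the ball, so it lies on the relative frontier.
  That frontier is the union of the facets, which are edges because the ball has dimension
  2.\<close>

lemma unit_vector_in_edge:
  fixes N :: "real^2 \<Rightarrow> real"
  assumes N: "is_norm_fun N" and poly: "polytope {x. N x \<le> 1}" and x: "N x = 1"
  shows "\<exists>F. F edge_of {x. N x \<le> 1} \<and> x \<in> F"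
proof -
  let ?B = "{x. N x \<le> 1}"
  have x0: "norm x > 0" using x is_norm_fun_0[OF N] by (cases "x = 0") auto
  have "x \<notin> interior ?B"
  proof
    assume "x \<in> interior ?B"
    then obtain e where e: "e > 0" "ball x e \<subseteq> ?B" unfolding mem_interior by blast
    define t where "t = 1 + e / (2 * norm x)"
    have "dist x (t *\<^sub>R x) = e / 2"
      using e(1) x0 by (simp add: t_def dist_norm algebra_simps)
    then have "N (t *\<^sub>R x) \<le> 1" using e by force
    moreover have "N (t *\<^sub>R x) = \<bar>t\<bar> * N x" using N unfolding is_norm_fun_def by blast
    moreover have "t > 1" using e(1) x0 by (simp add: t_def)
    ultimately show False using x by simp
  qed
  moreover have "rel_interior ?B = interior ?B"
    by (rule rel_interior_nonempty_interior[OF aff_dim_unit_ball(1)[OF N]])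
  moreover have "x \<in> closure ?B" using x closure_subset by fastforce
  ultimately have "x \<in> rel_frontier ?B" by (simp add: rel_frontier_def)
  then obtain F where "F facet_of ?B" "x \<in> F"
    using rel_frontier_of_polyhedron[OF polytope_imp_polyhedron[OF poly]] by blast
  then show ?thesis
    using aff_dim_unit_ball(2)[OF N] by (auto simp: facet_of_def edge_of_def)
qed

text \<open>An edge is a proper face by dimension, and a proper face misses the interior, which
  contains the open unit ball.\<close>

lemma edge_norm_eq_1:
  fixes N :: "real^2 \<Rightarrow> real"
  assumes N: "is_norm_fun N" and F: "F edge_of {x. N x \<le> 1}" and x: "x \<in> F"
  shows "N x = 1"
proof -
  let ?B = "{x. N x \<le> 1}"
  have "F face_of ?B" "F \<noteq> ?B"
    using F aff_dim_unit_ball(2)[OF N] by (auto simp: edge_of_def)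
  then have "x \<notin> interior ?B" using face_of_disjoint_interior x by blast
  then have "\<not> N x < 1" using less_1_subset_interior[OF N] by blast
  moreover have "x \<in> ?B" using edge_of_imp_subset[OF F] x by blast
  ultimately show ?thesis by simp
qed

text \<open>Two distinct points of norm 1 on a line through 0 are antipodal. By convexity their
  midpoint 0 would lie in the edge, where the norm is 1.\<close>

lemma edge_through_origin:
  fixes N :: "real^2 \<Rightarrow> real"
  assumes N: "is_norm_fun N" and F: "F edge_of {x. N x \<le> 1}"
    and pq: "a *\<^sub>R v \<in> F" "b *\<^sub>R v \<in> F"
  shows "a *\<^sub>R v = b *\<^sub>R v"
proof (rule ccontr)
  assume ne: "a *\<^sub>R v \<noteq> b *\<^sub>R v"
  have "\<bar>a\<bar> * N v = 1" "\<bar>b\<bar> * N v = 1"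
    using edge_norm_eq_1[OF N F pq(1)] edge_norm_eq_1[OF N F pq(2)] N unfolding is_norm_fun_def by metis+
  then have "\<bar>a\<bar> = \<bar>b\<bar>" by (metis mult_cancel_right mult_zero_right zero_neq_one)
  with ne have "b = - a" by (auto simp: abs_eq_iff)
  moreover have "convex F"
    using F face_of_imp_convex by (auto simp: edge_of_def)
  ultimately have "(1/2) *\<^sub>R (a *\<^sub>R v) + (1/2) *\<^sub>R ((- a) *\<^sub>R v) \<in> F"
    using pq by (intro convexD) auto
  then have "0 \<in> F" by simp
  then show False
    using edge_norm_eq_1[OF N F] is_norm_fun_0[OF N] by force
qed

text \<open>The linear functional whose level lines have slope \<open>s\<close>. The value
  \<open>MInfty\<close> never arises from \<open>seg_slope\<close>.\<close>

definition slope_functional :: "ereal \<Rightarrow> real^2 \<Rightarrow> real" where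
  "slope_functional s z = (if s = PInfty then z $ 1 else z $ 2 - real_of_ereal s * z $ 1)"

lemma linear_slope_functional: "linear (slope_functional s)"
  by (auto simp: slope_functional_def intro!: linearI simp: algebra_simps)

text \<open>A set of affine dimension 1 has two distinct points, so the choice in
  \<open>edge_slope\<close> has a genuine witness pair.\<close>

lemma edge_slope_witness:
  assumes "aff_dim F = 1"
  obtains p q where "p \<in> F" "q \<in> F" "p \<noteq> q" "edge_slope F = seg_slope p q"
proof -
  have "\<exists>p\<in>F. \<exists>q\<in>F. p \<noteq> q"
  proof (rule ccontr)
    assume *: "\<not> (\<exists>p\<in>F. \<exists>q\<in>F. p \<noteq> q)"
    have "F \<noteq> {}" using assms by force
    with * obtain p where "F = {p}" by blast
    then show False using assms by simp
  qed
  then have "\<exists>s. \<exists>p\<in>F. \<exists>q\<in>F. p \<noteq> q \<and> s = seg_slope p q" by blast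
  from someI_ex[OF this] show ?thesis
    using that unfolding edge_slope_def by blast
qed

text \<open>The functional agrees at the two points that define the slope, hence is constant on the
  line through them, which contains the edge. Were the constant 0, both points would lie on one line
  through the origin.\<close>

lemma slope_functional_edge:
  fixes N :: "real^2 \<Rightarrow> real"
  assumes N: "is_norm_fun N" and F: "F edge_of {x. N x \<le> 1}"
  shows "\<exists>h. h \<noteq> 0 \<and> (\<forall>x\<in>F. slope_functional (edge_slope F) x = h)"
proof -
  let ?f = "slope_functional (edge_slope F)"
  have dim: "aff_dim F = 1" using F by (simp add: edge_of_def)
  obtain p q where pq: "p \<in> F" "q \<in> F" "p \<noteq> q" and slope: "edge_slope F = seg_slope p q"
    using edge_slope_witness[OF dim] by blast
  have eq: "?f p = ?f q"
    unfolding slope by (auto simp: slope_functional_def seg_slope_def field_simps)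
  have "affine hull {p, q} = affine hull F"
    using pq dim by (intro affine_dim_equal) (auto simp: aff_dim_affine_hull aff_dim_2 hull_mono)
  then have F_line: "x \<in> affine hull {p, q}" if "x \<in> F" for x
    using that hull_subset[of F affine] by blast
  have const: "?f x = ?f p" if "x \<in> F" for x
  proof -
    obtain u v where uv: "x = u *\<^sub>R p + v *\<^sub>R q" "u + v = 1"
      using F_line[OF \<open>x \<in> F\<close>] unfolding affine_hull_2 by blast
    then have "?f x = u * ?f p + v * ?f p"
      using linear_add[OF linear_slope_functional] linear_scale[OF linear_slope_functional] eq
      by (metis real_scaleR_def)
    then show ?thesis using uv(2) by (metis distrib_right mult_1)
  qed
  moreover have "?f p \<noteq> 0"
  proof
    assume "?f p = 0"
    then have zero: "?f p = 0" "?f q = 0" using eq by auto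
    \<comment> \<open>A vector spanning the kernel of the functional.\<close>
    define v where "v = (if edge_slope F = PInfty then axis 2 1
      else axis 1 1 + real_of_ereal (edge_slope F) *\<^sub>R axis 2 (1::real) :: real^2)"
    have "\<exists>a. z = a *\<^sub>R v" if "?f z = 0" for z
      using that by (intro exI[of _ "if edge_slope F = PInfty then z $ 2 else z $ 1"])
        (auto simp: v_def slope_functional_def vec_eq_iff forall_2 axis_def)
    then obtain a b where "p = a *\<^sub>R v" "q = b *\<^sub>R v" using zero by blast
    then show False using edge_through_origin[OF N F, of a v b] pq by simp
  qed
  ultimately show ?thesis by blast
qed

text \<open>The normalised vector lies on an edge, where the functional has a nonzero constant
  value; its reciprocal is the factor. The factor depends on the edge only, so finitely many factors
  occur.\<close>

lemma norm_eq_slope_functional: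
  fixes N :: "real^2 \<Rightarrow> real"
  assumes N: "is_norm_fun N" and poly: "polytope {x. N x \<le> 1}"
  shows "\<exists>h. \<forall>z. z \<noteq> 0 \<longrightarrow> (\<exists>F. F edge_of {x. N x \<le> 1} \<and> N z = h F * slope_functional (edge_slope F) z)"
proof -
  have "\<exists>h. F edge_of {x. N x \<le> 1} \<longrightarrow> h \<noteq> 0 \<and> (\<forall>x\<in>F. slope_functional (edge_slope F) x = h)" for F
    using slope_functional_edge[OF N] by blast
  then obtain h where h: "\<And>F. F edge_of {x. N x \<le> 1} \<Longrightarrow>
      h F \<noteq> 0 \<and> (\<forall>x\<in>F. slope_functional (edge_slope F) x = h F)"
    by metis
  have "\<exists>F. F edge_of {x. N x \<le> 1} \<and> N z = 1 / h F * slope_functional (edge_slope F) z" if "z \<noteq> 0" for z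
  proof -
    have pos: "N z > 0" using is_norm_fun_pos[OF N that] .
    have "N ((1 / N z) *\<^sub>R z) = \<bar>1 / N z\<bar> * N z"
      using N unfolding is_norm_fun_def by blast
    then have "N ((1 / N z) *\<^sub>R z) = 1" using pos by simp
    then obtain F where F: "F edge_of {x. N x \<le> 1}" "(1 / N z) *\<^sub>R z \<in> F"
      using unit_vector_in_edge[OF N poly] by blast
    have "slope_functional (edge_slope F) ((1 / N z) *\<^sub>R z) = h F" using h[OF F(1)] F(2) by blast
    then have "slope_functional (edge_slope F) z / N z = h F"
      by (simp add: linear_scale[OF linear_slope_functional])
    then have "N z = 1 / h F * slope_functional (edge_slope F) z"
      using h[OF F(1)] pos by (auto simp: field_simps)
    with F(1) show ?thesis by blast
  qed
  then show ?thesis by (intro exI[of _ "\<lambda>F. 1 / h F"]) blast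
qed

section \<open>The distance set\<close>

text \<open>Apart from 0, every distance lies in the image of the null set \<open>T\<close> under
  the scaling attached to one of the finitely many edges.\<close>

lemma negligible_dist_set:
  fixes N :: "real^2 \<Rightarrow> real"
  assumes N: "is_norm_fun N" and poly: "polytope {x. N x \<le> 1}"
    and slopes: "edge_slope ` {F. F edge_of {x. N x \<le> 1}} \<subseteq> insert PInfty (ereal ` S)"
    and S: "finite S" "0 \<in> S"
    and C: "\<And>c. c \<in> S \<Longrightarrow> negligible (twisted_diffs c C)"
  shows "negligible (dist_set N {z. \<forall>k. z $ k \<in> C})"
proof -
  let ?edges = "{F. F edge_of {x. N x \<le> 1}}"
  define T where "T = (\<Union>c\<in>S. twisted_diffs c C)"
  have T: "negligible T" unfolding T_def using S(1) C by (intro negligible_Union) auto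
  obtain h where h: "\<And>z. z \<noteq> 0 \<Longrightarrow> \<exists>F. F edge_of {x. N x \<le> 1} \<and> N z = h F * slope_functional (edge_slope F) z"
    using norm_eq_slope_functional[OF N poly] by blast
  have in_T: "slope_functional (edge_slope F) (z - z') \<in> T"
    if F: "F \<in> ?edges" and z: "\<forall>k. z $ k \<in> C" "\<forall>k. z' $ k \<in> C" for F z z'
  proof (cases "edge_slope F = PInfty")
    case True
    \<comment> \<open>For a vertical edge the functional is the first coordinate, whose differences
      are twisted differences with factor 0.\<close>
    then have "slope_functional (edge_slope F) (z - z') = z $ 1 - 0 * z $ 1 - (z' $ 1 - 0 * z' $ 1)"
      by (simp add: slope_functional_def)
    also have "\<dots> \<in> twisted_diffs 0 C" unfolding twisted_diffs_def using z by blast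
    finally show ?thesis unfolding T_def using S(2) by blast
  next
    case False
    then obtain c where c: "c \<in> S" "edge_slope F = ereal c" using slopes F by blast
    then have "slope_functional (edge_slope F) (z - z') = z $ 2 - c * z $ 1 - (z' $ 2 - c * z' $ 1)"
      by (simp add: slope_functional_def algebra_simps)
    also have "\<dots> \<in> twisted_diffs c C" unfolding twisted_diffs_def using z by blast
    finally show ?thesis unfolding T_def using c(1) by blast
  qed
  have "finite ?edges"
    by (rule finite_subset[OF _ finite_polytope_faces[OF poly]]) (auto simp: edge_of_def)
  moreover have "negligible ((\<lambda>r. h F * r) ` T)" for F
    by (intro negligible_differentiable_image_negligible T differentiable_on_mult differentiable_on_const
        differentiable_on_id[unfolded id_def]) simp
  ultimately have "negligible (insert 0 (\<Union>F\<in>?edges. (\<lambda>r. h F * r) ` T))"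
    unfolding negligible_insert by (intro negligible_Union) auto
  moreover have "dist_set N {z. \<forall>k. z $ k \<in> C} \<subseteq> insert 0 (\<Union>F\<in>?edges. (\<lambda>r. h F * r) ` T)"
  proof
    fix r assume "r \<in> dist_set N {z. \<forall>k. z $ k \<in> C}"
    then obtain z z' where r: "r = N (z - z')" and z: "\<forall>k. z $ k \<in> C" "\<forall>k. z' $ k \<in> C"
      unfolding dist_set_def by blast
    show "r \<in> insert 0 (\<Union>F\<in>?edges. (\<lambda>r. h F * r) ` T)"
    proof (cases "z - z' = 0")
      case True
      then show ?thesis using is_norm_fun_0[OF N] r by simp
    next
      case False
      then obtain F where F: "F \<in> ?edges" "N (z - z') = h F * slope_functional (edge_slope F) (z - z')"
        using h by blast
      then show ?thesis using in_T[OF F(1) z] r by blast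
    qed
  qed
  ultimately show ?thesis by (rule negligible_subset)
qed

theorem theorem4:
  fixes \<gamma> :: "real^'d::finite" and N :: "real^2 \<Rightarrow> real"
  assumes KM: "KM_condition \<gamma>"
    and norm: "is_norm_fun N"
    and poly: "polytope {x. N x \<le> 1}"
    and sides: "card {F. F edge_of {x. N x \<le> 1}} = 2 * (CARD('d) + 3)"
    and slopes: "edge_slope ` {F. F edge_of {x. N x \<le> 1}}
                   = (\<lambda>k. ereal (\<gamma> $ k)) ` UNIV \<union> {ereal 0, ereal 1, PInfty}"
    and nonpar: "card ((\<lambda>k. ereal (\<gamma> $ k)) ` UNIV \<union> {ereal 0, ereal 1, PInfty}) = CARD('d) + 3"
  shows "\<exists>E :: (real^2) set. compact E \<and> hausdorff_dim (\<lambda>x y. N (x - y)) E = 2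
           \<and> dist_set N E \<in> null_sets lebesgue"
proof -
  let ?S = "insert 0 (insert 1 (range (($) \<gamma>)))"
  obtain M \<delta> a where sys: "digit_system M \<delta> a"
    and D: "\<And>c j. c \<in> ?S \<Longrightarrow> finite (twisted_diffs c (a j ` {..<M j}))"
      "\<And>c j. c \<in> ?S \<Longrightarrow> real (card (twisted_diffs c (a j ` {..<M j}))) * \<delta> j \<le> 1/2"
    and growth: "\<And>\<alpha>. \<lbrakk>0 < \<alpha>; \<alpha> < 1\<rbrakk> \<Longrightarrow>
      \<exists>c>0. \<forall>i. c \<le> real (digit_system.pieces M i) * digit_system.scale \<delta> (Suc i) powr \<alpha>"
    using exists_digit_system[of ?S, OF exists_digits[OF KM]] by blast
  interpret digit_system M \<delta> a by (rule sys)
  define E :: "(real^2) set" where "E = {z. \<forall>k. z $ k \<in> cantor_set}"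
  have E_cube: "E \<subseteq> cbox 0 1"
    using cantor_set_bounds by (auto simp: E_def mem_box_cart subset_eq)
  have "closed E"
  proof -
    have "E = (\<Inter>k. (\<lambda>z. z $ k) -` cantor_set)" by (auto simp: E_def)
    moreover have "closed ((\<lambda>z :: real^2. z $ k) -` cantor_set)" for k
      by (intro closed_vimage compact_imp_closed[OF compact_cantor_set] continuous_intros)
    ultimately show ?thesis by (simp add: closed_INT)
  qed
  then have "compact E"
    using E_cube bounded_subset[OF bounded_cbox] by (simp add: compact_eq_bounded_closed)
  moreover have "hausdorff_dim (\<lambda>x y. N (x - y)) E = 2"
  proof (rule hausdorff_dim_eq_2)
    have place: "place ` {0..<1} \<subseteq> cantor_set"
      unfolding cantor_set_def by (rule closure_subset)
    have "(\<chi> k. place 0) \<in> E" using place by (auto simp: E_def)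
    then have "E \<noteq> {}" by blast
    obtain R where R: "R > 0" "\<And>z k. \<bar>z $ k\<bar> \<le> R * N z"
      using is_norm_fun_lower_bound[OF norm polytope_imp_bounded[OF poly]] by blast
    show "hausdorff_measure (\<lambda>x y. N (x - y)) s E \<noteq> 0" if s: "0 \<le> s" "s < 2" for s
    proof (cases "s = 0")
      case True
      then show ?thesis using hausdorff_measure_0_pos[OF \<open>E \<noteq> {}\<close>] by simp
    next
      case False
      \<comment> \<open>Exponent s in the plane corresponds to the Hoelder exponent s/2 in each
        coordinate.\<close>
      then have \<alpha>: "0 < s / 2" "s / 2 < 1" using s by auto
      obtain c where c: "c > 0" "\<And>i. c \<le> real (pieces i) * scale (Suc i) powr (s / 2)"
        using growth[OF \<alpha>] by blast
      have "hausdorff_measure (\<lambda>x y. N (x - y)) (2 * (s / 2)) {z. \<forall>k. z $ k \<in> cantor_set} \<noteq> 0"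
        by (rule hausdorff_measure_cube_pos[OF place c(1) place_Holder[OF c] \<alpha>(1) R]) (use \<alpha> in auto)
      then show ?thesis by (simp add: E_def)
    qed
    obtain R' where R': "R' > 0" "\<And>z. N z \<le> R' * (\<bar>z $ 1\<bar> + \<bar>z $ 2\<bar>)"
      using is_norm_fun_upper_bound[OF norm] by blast
    show "hausdorff_measure (\<lambda>x y. N (x - y)) s E = 0" if "s > 2" for s
      by (rule hausdorff_measure_planar_null[OF R' E_cube that])
  qed
  moreover have "negligible (dist_set N E)"
    unfolding E_def
  proof (rule negligible_dist_set[OF norm poly])
    show "edge_slope ` {F. F edge_of {x. N x \<le> 1}} \<subseteq> insert PInfty (ereal ` ?S)"
      unfolding slopes by auto
    show "negligible (twisted_diffs c cantor_set)" if "c \<in> ?S" for c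
      by (rule negligible_twisted_diffs) (use D that in auto)
  qed auto
  ultimately show ?thesis by (auto simp: negligible_iff_null_sets)
qed

end
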